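(* Fix an integer $m\ge 3$ and let $C_{2m}$ be the cycle graph on $2m$ vertices. Then: (1) every group $\mathrm{MH}_{k,l}(C_{2m})$ is torsion-free; (2) define $T:\mathbb Z\times\mathbb Z\to\mathbb Z$ by $T(k,l)=0$ if $k<0$ or $l<0$; $T(0,0)=2m$, $T(1,1)=4m$; and $T(k,l)=\max\{T(k-1,l-1),\,T(k-2,l-m)\}$ for all other $(k,l)$ with $k,l\ge0$. Then $\operatorname{rk}\mathrm{MH}_{k,l}(C_{2m})=T(k,l)$ for all integers $k,l$.
   Context: $d$ denotes the shortest-path distance. For vertices $x_0,\dots,x_k$ put $\ell(x_0,\dots,x_k)=\sum_{i=0}^{k-1}d(x_i,x_{i+1})$. The magnitude chain complex: $\mathrm{MC}_{k,l}(G)$ is the free abelian group on $I_{k,l}(G)=\{(x_0,\dots,x_k)\in V(G)^{k+1}: x_i\neq x_{i+1}\ \forall i,\ \ell(x_0,\dots,x_k)=l\}$, with differential $\partial=\sum_{i=1}^{k-1}(-1)^i\partial_i:\mathrm{MC}_{k,l}\to\mathrm{MC}_{k-1,l}$, where $\partial_i(x_0,\dots,x_k)=(x_0,\dots,\hat x_i,\dots,x_k)$ if deleting $x_i$ does not change $\ell$, and $0$ otherwise. Magnitude homology: $\mathrm{MH}_{k,l}(G)=H_k(\mathrm{MC}_{*,l}(G))$ (with $\mathbb Z$ coefficients); $\operatorname{rk}$ denotes rank. *)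

theory Defs
  imports Main
begin

definition is_walk :: "'a set \<Rightarrow> ('a \<Rightarrow> 'a \<Rightarrow> bool) \<Rightarrow> 'a list \<Rightarrow> bool" where
  "is_walk V E p \<longleftrightarrow> p \<noteq> [] \<and> set p \<subseteq> V \<and>
     (\<forall>i. Suc i < length p \<longrightarrow> E (p ! i) (p ! Suc i))"

definition graph_dist :: "'a set \<Rightarrow> ('a \<Rightarrow> 'a \<Rightarrow> bool) \<Rightarrow> 'a \<Rightarrow> 'a \<Rightarrow> nat" where
  "graph_dist V E x y =
     (LEAST n. \<exists>p. is_walk V E p \<and> length p = Suc n \<and> hd p = x \<and> last p = y)"

definition cycle_V :: "nat \<Rightarrow> nat set" where
  "cycle_V n = {..<n}"

definition cycle_E :: "nat \<Rightarrow> nat \<Rightarrow> nat \<Rightarrow> bool" where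
  "cycle_E n x y \<longleftrightarrow> x < n \<and> y < n \<and> (y = Suc x mod n \<or> x = Suc y mod n)"

definition cycle_dist :: "nat \<Rightarrow> nat \<Rightarrow> nat \<Rightarrow> nat" where
  "cycle_dist n = graph_dist (cycle_V n) (cycle_E n)"

definition tuple_len :: "('a \<Rightarrow> 'a \<Rightarrow> nat) \<Rightarrow> 'a list \<Rightarrow> int" where
  "tuple_len d xs = (\<Sum>i<length xs - 1. int (d (xs ! i) (xs ! Suc i)))"

definition mc_gens :: "'a set \<Rightarrow> ('a \<Rightarrow> 'a \<Rightarrow> nat) \<Rightarrow> int \<Rightarrow> int \<Rightarrow> 'a list set" where
  "mc_gens V d k l = {xs. 0 \<le> k \<and> length xs = nat k + 1 \<and> set xs \<subseteq> V \<and>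
      (\<forall>i. Suc i < length xs \<longrightarrow> xs ! i \<noteq> xs ! Suc i) \<and> tuple_len d xs = l}"

text \<open>Chains in MC_{k,l}: integer combinations of generators, i.e. functions
  supported on I_{k,l} (which is finite for finite graphs).\<close>

definition mc_chains :: "'a set \<Rightarrow> ('a \<Rightarrow> 'a \<Rightarrow> nat) \<Rightarrow> int \<Rightarrow> int \<Rightarrow> ('a list \<Rightarrow> int) set" where
  "mc_chains V d k l = {c. \<forall>xs. c xs \<noteq> 0 \<longrightarrow> xs \<in> mc_gens V d k l}"

definition del_at :: "nat \<Rightarrow> 'a list \<Rightarrow> 'a list" where
  "del_at i xs = take i xs @ drop (Suc i) xs"

definition mc_bd :: "'a set \<Rightarrow> ('a \<Rightarrow> 'a \<Rightarrow> nat) \<Rightarrow> int \<Rightarrow> int \<Rightarrow> ('a list \<Rightarrow> int) \<Rightarrow> ('a list \<Rightarrow> int)" where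
  "mc_bd V d k l c = (\<lambda>ys. \<Sum>xs\<in>mc_gens V d k l. \<Sum>i\<in>{1..<nat k}.
      (if del_at i xs = ys \<and> tuple_len d (del_at i xs) = l then (-1) ^ i * c xs else 0))"

definition mh_cycles :: "'a set \<Rightarrow> ('a \<Rightarrow> 'a \<Rightarrow> nat) \<Rightarrow> int \<Rightarrow> int \<Rightarrow> ('a list \<Rightarrow> int) set" where
  "mh_cycles V d k l = {c \<in> mc_chains V d k l. mc_bd V d k l c = (\<lambda>_. 0)}"

definition mh_boundaries :: "'a set \<Rightarrow> ('a \<Rightarrow> 'a \<Rightarrow> nat) \<Rightarrow> int \<Rightarrow> int \<Rightarrow> ('a list \<Rightarrow> int) set" where
  "mh_boundaries V d k l = mc_bd V d (k + 1) l ` mc_chains V d (k + 1) l"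

text \<open>MH_{k,l} = cycles / boundaries.  It is torsion-free iff whenever a nonzero multiple
  of a cycle is a boundary, the cycle itself is a boundary.\<close>

definition mh_torsion_free :: "'a set \<Rightarrow> ('a \<Rightarrow> 'a \<Rightarrow> nat) \<Rightarrow> int \<Rightarrow> int \<Rightarrow> bool" where
  "mh_torsion_free V d k l \<longleftrightarrow>
     (\<forall>c\<in>mh_cycles V d k l. \<forall>n::int. n \<noteq> 0 \<and> (\<lambda>xs. n * c xs) \<in> mh_boundaries V d k l
        \<longrightarrow> c \<in> mh_boundaries V d k l)"

text \<open>Rank of MH_{k,l}: the maximal size r of a Z-linearly independent family of classes,
  i.e. of cycles z_0..z_{r-1} such that no nontrivial integer combination is a boundary.\<close>

definition mh_indep :: "'a set \<Rightarrow> ('a \<Rightarrow> 'a \<Rightarrow> nat) \<Rightarrow> int \<Rightarrow> int \<Rightarrow> nat \<Rightarrow> bool" where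
  "mh_indep V d k l r \<longleftrightarrow>
     (\<exists>z :: nat \<Rightarrow> 'a list \<Rightarrow> int. (\<forall>i<r. z i \<in> mh_cycles V d k l) \<and>
        (\<forall>a :: nat \<Rightarrow> int. (\<lambda>xs. \<Sum>i<r. a i * z i xs) \<in> mh_boundaries V d k l
            \<longrightarrow> (\<forall>i<r. a i = 0)))"

definition mh_rank :: "'a set \<Rightarrow> ('a \<Rightarrow> 'a \<Rightarrow> nat) \<Rightarrow> int \<Rightarrow> int \<Rightarrow> nat" where
  "mh_rank V d k l = (GREATEST r. mh_indep V d k l r)"

function T_fun :: "int \<Rightarrow> int \<Rightarrow> int \<Rightarrow> int" where
  "T_fun m k l =
     (if k < 0 \<or> l < 0 then 0
      else if k = 0 \<and> l = 0 then 2 * m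
      else if k = 1 \<and> l = 1 then 4 * m
      else max (T_fun m (k - 1) (l - 1)) (T_fun m (k - 2) (l - m)))"
  by pat_completeness auto
termination
  by (relation "measure (\<lambda>(m, k, l). nat (k + 1))") auto

end

theory Submission
  imports Defs "HOL-Library.Function_Algebras"
begin

text \<open>
  Let \<open>U\<^sub>+\<close> and \<open>U\<^sub>-\<close> be the subcomplexes of tuples whose first step goes at most half way round
  the cycle in the positive, respectively negative, direction. Together they span everything in
  degrees \<open>k \<ge> 1\<close>, and their intersection consists of the tuples that start with an antipodal step,
  i.e.\ it is a copy of the whole complex shifted by \<open>(1, m)\<close>.
  The homotopy \<open>(x, x + j, \<dots>) \<mapsto> - (x, x + 1, x + j, \<dots>)\<close> retracts \<open>U\<^sub>+\<close> onto the tuples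
  \<open>(x, x + 1, \<dots>)\<close> that then turn back, a copy of \<open>U\<^sub>-\<close> shifted by \<open>(1, 1)\<close>; hence both halves are
  acyclic off the diagonal \<open>k = l\<close>. Mayer--Vietoris gives \<open>H\<^bsub>k,l\<^esub> = H\<^bsub>k-2,l-m\<^esub>\<close> for \<open>k < l\<close>.
  On the diagonal there are no boundaries, and cycles are the combinations of walks that turn
  back at every step, since a vertex at distance 2 is reached through a unique midpoint if \<open>m \<ge> 3\<close>.
\<close>

text \<open>The change of direction drives the acyclicity proof: what the retraction leaves of one
  half lives in the opposite half, with degree and length both lowered by 1. Hence acyclicity is
  proved for all orientations at once by induction on the degree; \<open>l - k\<close> stays
  positive, and the descent ends in degree 0, where every tuple has length 0. An antipodal step can
  be split off because no geodesic runs past an antipode: the end of such a step can never be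
  deleted, so prefixing it commutes with the boundary up to sign. The pair \<open>(2, m)\<close>
  consists of one degree lost to the connecting map, and one degree and length \<open>m\<close> lost
  with the antipodal step. What is carried through the recursion is not a rank but an isomorphism of
  the homology with a free group on a finite set, so rank and torsion-freeness travel together. On
  the side of \<open>T_fun\<close> the maximum is never a real choice: for \<open>k < l\<close> its
  second argument dominates, and on the diagonal the second argument is 0.\<close>

section \<open>Free quotients of groups of integer functions\<close>

definition linear_on :: "('b \<Rightarrow> int) set \<Rightarrow> (('b \<Rightarrow> int) \<Rightarrow> ('c \<Rightarrow> int)) \<Rightarrow> bool" where
  "linear_on Z F \<longleftrightarrow> (\<forall>c\<in>Z. \<forall>e\<in>Z. F (c + e) = F c + F e) \<and>
     (\<forall>c\<in>Z. \<forall>n. F (\<lambda>x. n * c x) = (\<lambda>x. n * F c x))"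

text \<open>For finite \<open>A\<close> this says that \<open>Z / B\<close> is free abelian of rank
  \<open>card A\<close>: \<open>\<Phi>\<close> has kernel \<open>B\<close> and maps onto the integer
  functions supported on \<open>A\<close>. No quotient type has to be formed.\<close>

definition free_quotient_on ::
    "('b \<Rightarrow> int) set \<Rightarrow> ('b \<Rightarrow> int) set \<Rightarrow> 'c set \<Rightarrow> bool" where
  "free_quotient_on Z B A \<longleftrightarrow> (\<exists>\<Phi>. linear_on Z \<Phi> \<and> (\<forall>c\<in>Z. \<forall>x. \<Phi> c x \<noteq> 0 \<longrightarrow> x \<in> A) \<and>
     (\<forall>c\<in>Z. \<Phi> c = 0 \<longleftrightarrow> c \<in> B) \<and>
     (\<forall>g. (\<forall>x. g x \<noteq> 0 \<longrightarrow> x \<in> A) \<longrightarrow> (\<exists>c\<in>Z. \<Phi> c = g)))"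

lemma linear_onD:
  assumes "linear_on Z F" "c \<in> Z"
  shows "e \<in> Z \<Longrightarrow> F (c + e) = F c + F e" "F (\<lambda>x. n * c x) = (\<lambda>x. n * F c x)"
  using assms by (auto simp: linear_on_def)

lemma linear_on_compose:
  assumes "linear_on Z F" "linear_on Z' G" "\<And>c. c \<in> Z \<Longrightarrow> F c \<in> Z'"
  shows "linear_on Z (\<lambda>c. G (F c))"
  using assms by (auto simp: linear_on_def)

text \<open>\<open>F\<close> only has to induce a bijection of quotients: \<open>ker\<close> makes
  it well defined and injective on classes, and surjectivity is asked modulo \<open>B'\<close> only.
  This fits a connecting homomorphism, which depends on choices at the level of chains.\<close>

lemma free_quotient_on_transport:
  assumes fr: "free_quotient_on Z' B' A" and lin: "linear_on Z F"
    and FZ: "\<And>c. c \<in> Z \<Longrightarrow> F c \<in> Z'"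
    and ker: "\<And>c. c \<in> Z \<Longrightarrow> F c \<in> B' \<longleftrightarrow> c \<in> B"
    and onto: "\<And>y. y \<in> Z' \<Longrightarrow> \<exists>c\<in>Z. F c - y \<in> B'"
    and sub: "B' \<subseteq> Z'"
  shows "free_quotient_on Z B A"
proof -
  obtain \<Phi> where lin': "linear_on Z' \<Phi>" and supp: "\<forall>c\<in>Z'. \<forall>x. \<Phi> c x \<noteq> 0 \<longrightarrow> x \<in> A"
    and ker': "\<forall>c\<in>Z'. \<Phi> c = 0 \<longleftrightarrow> c \<in> B'"
    and onto': "\<forall>g. (\<forall>x. g x \<noteq> 0 \<longrightarrow> x \<in> A) \<longrightarrow> (\<exists>c\<in>Z'. \<Phi> c = g)"
    using fr unfolding free_quotient_on_def by blast
  have "\<exists>c\<in>Z. \<Phi> (F c) = g" if g: "\<forall>x. g x \<noteq> 0 \<longrightarrow> x \<in> A" for g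
  proof -
    obtain y where y: "y \<in> Z'" "\<Phi> y = g" using onto' g by blast
    obtain c where c: "c \<in> Z" "F c - y \<in> B'" using onto y(1) by blast
    have "\<Phi> ((F c - y) + y) = \<Phi> (F c - y) + \<Phi> y"
      using linear_onD(1)[OF lin'] c(2) y(1) sub by blast
    moreover have "\<Phi> (F c - y) = 0" using ker' c(2) sub by blast
    ultimately show ?thesis using c(1) y(2) by auto
  qed
  moreover have "linear_on Z (\<lambda>c. \<Phi> (F c))" by (rule linear_on_compose[OF lin lin' FZ])
  ultimately show ?thesis unfolding free_quotient_on_def
    using FZ supp ker ker' by (intro exI[of _ "\<lambda>c. \<Phi> (F c)"]) auto
qed


lemma free_quotient_on_trivial:
  assumes "Z = B" "Z \<noteq> {}"
  shows "free_quotient_on Z B {}"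
  unfolding free_quotient_on_def
  using assms by (intro exI[of _ "\<lambda>_. 0"]) (auto simp: linear_on_def fun_eq_iff)

text \<open>Gaussian elimination without division: a pivot \<open>j\<close> at coordinate
  \<open>p\<close> is used to clear that coordinate by cross-multiplication, which keeps everything
  integral and removes one vector and one coordinate.\<close>

lemma int_vectors_dependent:
  fixes v :: "'i \<Rightarrow> 'b \<Rightarrow> int"
  assumes "finite A" "finite I" "card A < card I" "\<And>i x. i \<in> I \<Longrightarrow> v i x \<noteq> 0 \<Longrightarrow> x \<in> A"
  shows "\<exists>a. (\<exists>i\<in>I. a i \<noteq> 0) \<and> (\<forall>x. (\<Sum>i\<in>I. a i * v i x) = (0::int))"
  using assms
proof (induction A arbitrary: I v rule: finite_induct)
  case empty
  then show ?case by (intro exI[of _ "\<lambda>_. 1"]) (force simp: card_gt_0_iff intro!: sum.neutral)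
next
  case (insert p A)
  show ?case
  proof (cases "\<forall>i\<in>I. v i p = 0")
    case True
    have "\<exists>a. (\<exists>i\<in>I. a i \<noteq> 0) \<and> (\<forall>x. (\<Sum>i\<in>I. a i * v i x) = 0)"
    proof (rule insert.IH)
      show "card A < card I" using insert by simp
    qed (use insert.prems True in force)+
    then show ?thesis .
  next
    case False
    then obtain j where j: "j \<in> I" "v j p \<noteq> 0" by blast
    define w where "w i x = v j p * v i x - v i p * v j x" for i x
    have "\<exists>a. (\<exists>i\<in>I - {j}. a i \<noteq> 0) \<and> (\<forall>x. (\<Sum>i\<in>I - {j}. a i * w i x) = 0)"
    proof (rule insert.IH)
      show "card A < card (I - {j})" using insert j by simp
      show "x \<in> A" if "i \<in> I - {j}" "w i x \<noteq> 0" for i x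
      proof -
        have "x \<noteq> p" using that(2) by (auto simp: w_def)
        moreover have "v i x \<noteq> 0 \<or> v j x \<noteq> 0" using that(2) by (auto simp: w_def)
        ultimately show ?thesis using insert.prems(3) that(1) j(1) by blast
      qed
    qed (use insert.prems in auto)
    then obtain a where a: "\<exists>i\<in>I - {j}. a i \<noteq> 0" "\<And>x. (\<Sum>i\<in>I - {j}. a i * w i x) = 0" by blast
    \<comment> \<open>Expanding each \<open>w i\<close> in the relation for the eliminated vectors
      and collecting the multiples of \<open>v j\<close> gives these coefficients. A nonzero
      \<open>a i\<close> stays nonzero since \<open>v j p\<close> is nonzero.\<close>
    define a' where "a' i = (if i = j then - (\<Sum>i\<in>I - {j}. a i * v i p) else a i * v j p)" for i
    have "(\<Sum>i\<in>I. a' i * v i x) = 0" for x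
    proof -
      have "(\<Sum>i\<in>I. a' i * v i x) = a' j * v j x + (\<Sum>i\<in>I - {j}. a' i * v i x)"
        using j insert.prems by (simp add: sum.remove)
      also have "(\<Sum>i\<in>I - {j}. a' i * v i x) = (\<Sum>i\<in>I - {j}. a i * v j p * v i x)"
        by (intro sum.cong) (auto simp: a'_def)
      also have "a' j * v j x + \<dots> = (\<Sum>i\<in>I - {j}. a i * w i x)"
        by (simp add: a'_def w_def algebra_simps sum_distrib_left sum_subtractf)
      finally show ?thesis using a by simp
    qed
    moreover have "\<exists>i\<in>I. a' i \<noteq> 0" using a(1) j by (auto simp: a'_def)
    ultimately show ?thesis by blast
  qed
qed

section \<open>The magnitude complex of a finite metric\<close>

locale finite_metric =
  fixes V :: "'a set" and d :: "'a \<Rightarrow> 'a \<Rightarrow> nat"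
  assumes finite_V: "finite V"
    and d_eq_0: "x \<in> V \<Longrightarrow> y \<in> V \<Longrightarrow> d x y = 0 \<longleftrightarrow> x = y"
    and d_triangle: "x \<in> V \<Longrightarrow> y \<in> V \<Longrightarrow> z \<in> V \<Longrightarrow> d x z \<le> d x y + d y z"
begin

definition between :: "'a \<Rightarrow> 'a \<Rightarrow> 'a set" where
  "between x z = {v \<in> V. x \<in> V \<and> z \<in> V \<and> v \<noteq> x \<and> v \<noteq> z \<and> d x v + d v z = d x z}"

fun len :: "'a list \<Rightarrow> nat" where
  "len (x # y # t) = d x y + len (y # t)"
| "len _ = 0"

definition generator :: "nat \<Rightarrow> nat \<Rightarrow> 'a list \<Rightarrow> bool" where
  "generator k l xs \<longleftrightarrow> length xs = Suc k \<and> set xs \<subseteq> V \<and> distinct_adj xs \<and> len xs = l"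

definition chains :: "nat \<Rightarrow> nat \<Rightarrow> ('a list \<Rightarrow> int) set" where
  "chains k l = {c. \<forall>xs. c xs \<noteq> 0 \<longrightarrow> generator k l xs}"

text \<open>Peeling off the first vertex lets the boundary be written for all degrees and lengths at once:
  the coefficient at a tuple collects the coefficients of all its length-preserving insertions.\<close>

fun bd :: "('a list \<Rightarrow> int) \<Rightarrow> 'a list \<Rightarrow> int" where
  "bd c (y # z # r) = - (\<Sum>v\<in>between y z. c (y # v # z # r)) - bd (\<lambda>t. c (y # t)) (z # r)"
| "bd c _ = 0"

definition cycles :: "nat \<Rightarrow> nat \<Rightarrow> ('a list \<Rightarrow> int) set" where
  "cycles k l = {c \<in> chains k l. bd c = 0}"

definition boundaries :: "nat \<Rightarrow> nat \<Rightarrow> ('a list \<Rightarrow> int) set" where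
  "boundaries k l = bd ` chains (Suc k) l"

lemma finite_between [simp]: "finite (between x z)"
  using finite_V by (auto simp: between_def)

text \<open>Both sides say that \<open>x\<close>, \<open>w\<close>, \<open>v\<close>,
  \<open>z\<close> lie in this order on a geodesic, so two insertions into the same gap can be made
  in either order.\<close>

lemma between_flip:
  "v \<in> between x z \<and> w \<in> between x v \<longleftrightarrow> w \<in> between x z \<and> v \<in> between w z"
proof (cases "x \<in> V \<and> z \<in> V \<and> v \<in> V \<and> w \<in> V")
  case True
  then have tri: "d x z \<le> d x w + d w z" "d w z \<le> d w v + d v z" "d x z \<le> d x v + d v z"
      "d x v \<le> d x w + d w v"
    by (simp_all add: d_triangle)
  have mem: "b \<in> between a c \<longleftrightarrow> 0 < d a b \<and> 0 < d b c \<and> d a b + d b c = d a c"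
    if "a \<in> V" "b \<in> V" "c \<in> V" for a b c
    using that d_eq_0[of a b] d_eq_0[of b c] by (auto simp: between_def)
  show ?thesis using True by (simp add: mem) (intro iffI conjI; elim conjE; use tri in linarith)
qed (auto simp: between_def)

text \<open>The first vertex is never deleted, so the boundary at a tuple only sees coefficients of
  tuples with the same first vertex. This permits rewriting under the peeled-off prefix.\<close>

lemma bd_cong:
  assumes "\<And>s. f (z # s) = g (z # s)"
  shows "bd f (z # r) = bd g (z # r)"
  using assms by (cases r) auto

lemma bd_add: "bd (c + e) = bd c + bd e"
proof
  show "bd (c + e) xs = (bd c + bd e) xs" for xs
    by (induction xs arbitrary: c e rule: induct_list012)
      (auto simp: sum.distrib plus_fun_def)
qed

lemma bd_scale: "bd (\<lambda>x. n * c x) = (\<lambda>x. n * bd c x)"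
proof
  show "bd (\<lambda>x. n * c x) xs = n * bd c xs" for xs
    by (induction xs arbitrary: c rule: induct_list012)
      (auto simp: sum_distrib_left algebra_simps)
qed

lemma bd_0 [simp]: "bd 0 = 0"
  using bd_scale[of 0 "0"] by (simp add: zero_fun_def)

lemma bd_minus: "bd (- c) = - bd c"
  using bd_scale[of "-1" c] by (simp add: fun_Compl_def)

lemma bd_diff: "bd (c - e) = bd c - bd e"
  using bd_add[of c "- e"] by (simp add: bd_minus)

lemma bd_sum: "finite S \<Longrightarrow> bd (\<lambda>t. \<Sum>v\<in>S. c v t) xs = (\<Sum>v\<in>S. bd (c v) xs)"
proof (induction S rule: finite_induct)
  case empty
  then show ?case using bd_0 by (simp add: zero_fun_def fun_eq_iff)
next
  case (insert v S)
  then show ?case using bd_add[of "c v" "\<lambda>t. \<Sum>v\<in>S. c v t"] by (simp add: plus_fun_def fun_eq_iff)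
qed

lemma bd_bd: "bd (bd c) = 0"
proof
  show "bd (bd c) xs = 0 xs" for xs
  proof (induction xs arbitrary: c rule: induct_list012)
    case (3 y z r)
    have "bd (\<lambda>t. bd c (y # t)) (z # r)
        = bd (- (\<lambda>t. \<Sum>v\<in>between y z. c (y # v # t)) - bd (\<lambda>t. c (y # t))) (z # r)"
      by (rule bd_cong) simp
    also have "\<dots> = - (\<Sum>v\<in>between y z. bd (\<lambda>t. c (y # v # t)) (z # r))"
      using 3(2)[of "\<lambda>t. c (y # t)"] by (simp add: bd_diff bd_minus bd_sum)
    finally have 1: "bd (\<lambda>t. bd c (y # t)) (z # r) = \<dots>" .
    \<comment> \<open>What remains are the terms with both new vertices in the first gap. They occur
      twice with opposite signs, the second vertex being placed before or after the first one;
      \<open>between_flip\<close> matches them.\<close>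
    have "(\<Sum>v\<in>between y z. \<Sum>w\<in>between y v. c (y # w # v # z # r))
        = (\<Sum>(v, w)\<in>Sigma (between y z) (\<lambda>v. between y v). c (y # w # v # z # r))"
      by (simp add: sum.Sigma)
    also have "\<dots> = (\<Sum>(v, w)\<in>Sigma (between y z) (\<lambda>v. between v z). c (y # v # w # z # r))"
      by (rule sum.reindex_bij_witness[of _ prod.swap prod.swap])
        (auto dest: conjI[THEN between_flip[THEN iffD1]] conjI[THEN between_flip[THEN iffD2]])
    also have "\<dots> = (\<Sum>v\<in>between y z. \<Sum>w\<in>between v z. c (y # v # w # z # r))"
      by (simp add: sum.Sigma)
    finally show ?case using 1
      by (simp add: sum_subtractf sum.distrib sum_negf)
  qed auto
qed

text \<open>The support of the boundary without its signs: arguments about degree, length and shape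
  only need to know which tuples can contribute to a coefficient.\<close>

inductive insertion :: "'a list \<Rightarrow> 'a list \<Rightarrow> bool" where
  "v \<in> between x y \<Longrightarrow> insertion (x # y # t) (x # v # y # t)"
| "insertion (y # t) (y # s) \<Longrightarrow> insertion (x # y # t) (x # y # s)"

lemma insertion_hd: "insertion (y # t) xs \<Longrightarrow> \<exists>s. xs = y # s"
  by (erule insertion.cases) auto

lemma insertion_length: "insertion ys xs \<Longrightarrow> length xs = Suc (length ys) \<and> 2 \<le> length ys"
  by (induction rule: insertion.induct) auto

lemma bd_nonzero: "bd c ys \<noteq> 0 \<Longrightarrow> \<exists>xs. insertion ys xs \<and> c xs \<noteq> 0"
proof (induction ys arbitrary: c rule: induct_list012)
  case (3 y z r)
  show ?case
  proof (cases "(\<Sum>v\<in>between y z. c (y # v # z # r)) = 0")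
    case True
    then obtain xs where xs: "insertion (z # r) xs" "c (y # xs) \<noteq> 0"
      using 3 by fastforce
    then obtain s where "xs = z # s" using insertion_hd by blast
    then show ?thesis using xs insertion.intros(2) by blast
  next
    case False
    then obtain v where "v \<in> between y z" "c (y # v # z # r) \<noteq> 0" by (meson sum.neutral)
    then show ?thesis by (auto intro: insertion.intros)
  qed
qed auto

text \<open>Removing \<open>v\<close> cannot make its neighbours \<open>x\<close> and
  \<open>y\<close> equal, because \<open>d x y = d x v + d v y\<close> is positive.\<close>

lemma insertion_generator:
  "insertion ys xs \<Longrightarrow> generator (Suc k) l xs \<Longrightarrow> generator k l ys"
proof (induction arbitrary: k l rule: insertion.induct)
  case (1 v x y t)
  then show ?case using d_eq_0[of x v] d_eq_0[of x y]
    by (auto simp: generator_def between_def)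
next
  case (2 y t s x)
  have g: "generator k (l - d x y) (y # s)" "d x y \<le> l" "x \<in> V" "x \<noteq> y"
    using 2(3) by (auto simp: generator_def)
  obtain k' where k': "k = Suc k'"
    using insertion_length[OF 2(1)] 2(3) by (cases k) (auto simp: generator_def)
  have "generator k' (l - d x y) (y # t)" using 2(2) g(1) k' by simp
  then show ?case using g(2-4) k' by (auto simp: generator_def)
qed

lemma bd_chains: "c \<in> chains (Suc k) l \<Longrightarrow> bd c \<in> chains k l"
  unfolding chains_def using bd_nonzero insertion_generator by blast

lemma bd_chains_0:
  assumes "c \<in> chains 0 l" shows "bd c = 0"
proof (rule ccontr)
  assume "bd c \<noteq> 0"
  then obtain ys where "bd c ys \<noteq> 0" by (auto simp: fun_eq_iff)
  then obtain xs where "insertion ys xs" "c xs \<noteq> 0" using bd_nonzero by blast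
  then show False using assms insertion_length by (fastforce simp: chains_def generator_def)
qed

lemma chains_0 [simp]: "0 \<in> chains k l"
  by (auto simp: chains_def)

lemma chains_add: "c \<in> chains k l \<Longrightarrow> e \<in> chains k l \<Longrightarrow> c + e \<in> chains k l"
  unfolding chains_def by (auto, metis add.right_neutral)

lemma chains_minus: "c \<in> chains k l \<Longrightarrow> - c \<in> chains k l"
  by (fastforce simp: chains_def)

lemma chains_diff: "c \<in> chains k l \<Longrightarrow> e \<in> chains k l \<Longrightarrow> c - e \<in> chains k l"
  using chains_add[of c k l "- e"] chains_minus by simp

lemma boundaries_subset_cycles: "boundaries k l \<subseteq> cycles k l"
  by (auto simp: boundaries_def cycles_def bd_chains bd_bd)

lemma le_len: "set xs \<subseteq> V \<Longrightarrow> distinct_adj xs \<Longrightarrow> length xs \<le> Suc (len xs)"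
proof (induction xs rule: induct_list012)
  case (3 x y t)
  then have "0 < d x y" using d_eq_0[of x y] by auto
  then show ?case using 3 by auto
qed auto

lemma chains_trivial: "l < k \<Longrightarrow> chains k l = {0}"
proof -
  assume "l < k"
  then have "\<not> generator k l xs" for xs using le_len[of xs] by (auto simp: generator_def)
  then show ?thesis by (auto simp: chains_def fun_eq_iff)
qed

section \<open>Orientations of an even cycle and the two halves\<close>

text \<open>Here \<open>b x y\<close> is the length of the arc from \<open>x\<close> to \<open>y\<close> in one fixed direction round the cycle;
  swapping its arguments reverses the direction.\<close>

definition orientation :: "nat \<Rightarrow> ('a \<Rightarrow> 'a \<Rightarrow> nat) \<Rightarrow> bool" where
  "orientation m b \<longleftrightarrow> 3 \<le> m \<and>
     (\<forall>x\<in>V. \<forall>y\<in>V. b x y < 2 * m \<and> (b x y = 0 \<longleftrightarrow> x = y) \<and> d x y = min (b x y) (b y x)) \<and>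
     (\<forall>x\<in>V. \<forall>y\<in>V. \<forall>z\<in>V. b x y + b y z = b x z \<or> b x y + b y z = b x z + 2 * m) \<and>
     (\<forall>x\<in>V. \<forall>j<2 * m. \<exists>y\<in>V. b x y = j)"

text \<open>Tuples with an antipodal first step lie in the halves of both directions. In degree 0
  there is no first step, and each half is the whole chain group.\<close>

definition half :: "nat \<Rightarrow> ('a \<Rightarrow> 'a \<Rightarrow> nat) \<Rightarrow> nat \<Rightarrow> nat \<Rightarrow> ('a list \<Rightarrow> int) set" where
  "half m b k l = {c \<in> chains k l. \<forall>x y t. c (x # y # t) \<noteq> 0 \<longrightarrow> b x y \<le> m}"

text \<open>Chains are coefficient functions, so the map is given by its value at the target tuple.
  The bounds on \<open>b x z\<close> say that the successor \<open>y\<close> of \<open>x\<close>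
  lies strictly between \<open>x\<close> and \<open>z\<close> on the forward side; the sign cancels
  the sign of deleting the second vertex.\<close>

fun homotopy :: "nat \<Rightarrow> ('a \<Rightarrow> 'a \<Rightarrow> nat) \<Rightarrow> ('a list \<Rightarrow> int) \<Rightarrow> 'a list \<Rightarrow> int" where
  "homotopy m b c (x # y # z # r) =
     (if x \<in> V \<and> y \<in> V \<and> b x y = 1 \<and> 2 \<le> b x z \<and> b x z \<le> m then - c (x # z # r) else 0)"
| "homotopy m b c _ = 0"

fun shift :: "('a \<Rightarrow> 'a \<Rightarrow> nat) \<Rightarrow> nat \<Rightarrow> ('a list \<Rightarrow> int) \<Rightarrow> 'a list \<Rightarrow> int" where
  "shift b j g (x # y # t) = (if x \<in> V \<and> y \<in> V \<and> b x y = j then g (y # t) else 0)"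
| "shift b j g _ = 0"

text \<open>The inverse of \<open>shift\<close> on chains whose first steps all have arc
  \<open>j\<close>: such a step is determined by its end, so \<open>SOME\<close> picks the only
  possible start.\<close>

fun unshift :: "('a \<Rightarrow> 'a \<Rightarrow> nat) \<Rightarrow> nat \<Rightarrow> ('a list \<Rightarrow> int) \<Rightarrow> 'a list \<Rightarrow> int" where
  "unshift b j c (y # t) = (if y \<in> V then c ((SOME x. x \<in> V \<and> b x y = j) # y # t) else 0)"
| "unshift b j c [] = 0"

lemma half_chains: "c \<in> half m b k l \<Longrightarrow> c \<in> chains k l"
  by (simp add: half_def)

lemma half_diff: "c \<in> half m b k l \<Longrightarrow> e \<in> half m b k l \<Longrightarrow> c - e \<in> half m b k l"
  unfolding half_def by (auto simp: chains_diff) (metis diff_0_right)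

lemma half_add: "c \<in> half m b k l \<Longrightarrow> e \<in> half m b k l \<Longrightarrow> c + e \<in> half m b k l"
  unfolding half_def by (auto simp: chains_add) (metis add.right_neutral)

lemma unshift_diff: "unshift b j (c - e) = unshift b j c - unshift b j e"
proof
  show "unshift b j (c - e) xs = (unshift b j c - unshift b j e) xs" for xs
    by (cases xs) auto
qed


lemma unshift_0 [simp]: "unshift b j 0 = 0"
  using unshift_diff[of b j 0 0] by simp

lemma half_0 [simp]: "0 \<in> half m b k l"
  by (simp add: half_def)

lemma half_minus: "c \<in> half m b k l \<Longrightarrow> - c \<in> half m b k l"
  using half_diff[OF half_0] by fastforce

lemma chains_ConsD:
  assumes "c \<in> chains k l" "c (x # y # t) \<noteq> 0"
  shows "x \<in> V" "y \<in> V" "x \<noteq> y"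
  using assms by (auto simp: chains_def generator_def)

lemma bd_Cons_nonzero:
  assumes "bd c (x # y # t) \<noteq> 0"
  shows "(\<exists>v\<in>between x y. c (x # v # y # t) \<noteq> 0) \<or> (\<exists>s. c (x # y # s) \<noteq> 0)"
proof (rule ccontr)
  assume neg: "\<not> ?thesis"
  have "bd (\<lambda>t. c (x # t)) (y # t) = bd (\<lambda>_. 0) (y # t)" by (rule bd_cong) (use neg in auto)
  then show False using assms neg bd_0 by (simp add: zero_fun_def fun_eq_iff)
qed

context
  fixes m :: nat and b :: "'a \<Rightarrow> 'a \<Rightarrow> nat"
  assumes orient: "orientation m b"
begin

lemma m_ge: "3 \<le> m"
  using orient by (simp add: orientation_def)

lemma arc_less: "x \<in> V \<Longrightarrow> y \<in> V \<Longrightarrow> b x y < 2 * m"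
  using orient by (simp add: orientation_def)

lemma arc_0: "x \<in> V \<Longrightarrow> y \<in> V \<Longrightarrow> b x y = 0 \<longleftrightarrow> x = y"
  using orient by (simp add: orientation_def)

lemma arc_dist: "x \<in> V \<Longrightarrow> y \<in> V \<Longrightarrow> d x y = min (b x y) (b y x)"
  using orient by (simp add: orientation_def)

lemma arc_add: "x \<in> V \<Longrightarrow> y \<in> V \<Longrightarrow> z \<in> V \<Longrightarrow>
    b x y + b y z = b x z \<or> b x y + b y z = b x z + 2 * m"
  using orient by (simp add: orientation_def)

lemma arc_ex: "x \<in> V \<Longrightarrow> j < 2 * m \<Longrightarrow> \<exists>y\<in>V. b x y = j"
  using orient by (simp add: orientation_def)

lemma arc_rev: "x \<in> V \<Longrightarrow> y \<in> V \<Longrightarrow> x \<noteq> y \<Longrightarrow> b x y + b y x = 2 * m"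
  using arc_add[of x y x] arc_0[of x y] arc_0[of x x] by auto

lemma dist_eq: "x \<in> V \<Longrightarrow> y \<in> V \<Longrightarrow> d x y = (if b x y \<le> m then b x y else 2 * m - b x y)"
  using arc_rev[of x y] arc_dist[of x y] arc_0[of x y] by (cases "x = y") auto

lemma arc_unique: "x \<in> V \<Longrightarrow> y \<in> V \<Longrightarrow> z \<in> V \<Longrightarrow> b x y = b x z \<Longrightarrow> y = z"
  using arc_add[of x y z] arc_less[of y z] arc_0[of y z] by auto

lemma arc_unique': "x \<in> V \<Longrightarrow> y \<in> V \<Longrightarrow> z \<in> V \<Longrightarrow> b x z = b y z \<Longrightarrow> x = y"
  using arc_add[of x y z] arc_less[of x y] arc_0[of x y] by auto

lemma arc_ex':
  assumes "x \<in> V" "j < 2 * m"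
  shows "\<exists>y\<in>V. b y x = j"
proof (cases "j = 0")
  case False
  then obtain y where "y \<in> V" "b x y = 2 * m - j" using arc_ex[of x "2 * m - j"] assms by auto
  then show ?thesis using arc_rev[of x y] arc_0[of x y] assms by (intro bexI[of _ y]) auto
qed (use assms arc_0 in auto)

text \<open>Makes every result on one half available for the other, and lets the induction in
  \<open>half_acyclic\<close> switch direction at each step.\<close>

lemma orientation_rev: "orientation m (\<lambda>x y. b y x)"
proof -
  have "b y x + b z y = b z x \<or> b y x + b z y = b z x + 2 * m" if "x \<in> V" "y \<in> V" "z \<in> V" for x y z
    using arc_add[of z y x] that by auto
  then show ?thesis
    unfolding orientation_def using m_ge arc_less arc_0 arc_dist arc_ex'
    by (auto simp: min.commute)
qed

text \<open>A geodesic whose initial piece runs forward runs forward throughout, so betweenness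
  becomes a comparison of arc lengths from \<open>x\<close>.\<close>

lemma between_arc:
  assumes "x \<in> V" "z \<in> V" "v \<in> V" "b x v \<le> m"
  shows "v \<in> between x z \<longleftrightarrow> v \<noteq> x \<and> v \<noteq> z \<and> b x z \<le> m \<and> b x v < b x z"
proof -
  have "b x v + b v z = b x z \<or> b x v + b v z = b x z + 2 * m" "b x v < 2 * m" "b v z < 2 * m" "b x z < 2 * m"
    using assms arc_add arc_less by auto
  moreover have "v \<noteq> x \<Longrightarrow> 0 < b x v" "v \<noteq> z \<Longrightarrow> 0 < b v z"
    using assms arc_0[of x v] arc_0[of v z] by auto
  ultimately show ?thesis
    using assms by (auto simp: between_def dist_eq split: if_splits)
qed

text \<open>Deleting the second vertex merges the first two steps into one geodesic, which keeps the
  direction of its initial piece; all other deletions keep the first step.\<close>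

lemma bd_half:
  assumes "c \<in> half m b (Suc k) l"
  shows "bd c \<in> half m b k l"
proof -
  have "b x y \<le> m" if nz: "bd c (x # y # t) \<noteq> 0" for x y t
    using bd_Cons_nonzero[OF nz]
  proof
    assume "\<exists>v\<in>between x y. c (x # v # y # t) \<noteq> 0"
    then obtain v where v: "v \<in> between x y" "b x v \<le> m" using assms by (auto simp: half_def)
    then show ?thesis using between_arc[of x y v] by (auto simp: between_def)
  qed (use assms in \<open>auto simp: half_def\<close>)
  then show ?thesis using assms by (auto simp: half_def bd_chains)
qed

lemma homotopy_half:
  assumes c: "c \<in> half m b k l"
  shows "homotopy m b c \<in> half m b (Suc k) l"
proof -
  have "generator (Suc k) l xs \<and> (\<forall>x y t. xs = x # y # t \<longrightarrow> b x y \<le> m)"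
    if nz: "homotopy m b c xs \<noteq> 0" for xs
  proof -
    obtain x y z r where xs: "xs = x # y # z # r"
      using nz by (cases "(m, b, c, xs)" rule: homotopy.cases) auto
    then have xyz: "x \<in> V" "y \<in> V" "b x y = 1" "2 \<le> b x z" "b x z \<le> m" "c (x # z # r) \<noteq> 0"
      using nz by (auto split: if_splits)
    then have g: "generator k l (x # z # r)" using c by (auto simp: half_def chains_def)
    then have "z \<in> V" by (auto simp: generator_def)
    have "b y z = b x z - 1" using arc_add[of x y z] arc_less[of y z] xyz \<open>z \<in> V\<close> by auto
    then have "d x y + d y z = d x z" "y \<noteq> z" "x \<noteq> y"
      using xyz \<open>z \<in> V\<close> m_ge arc_0[of x y] by (auto simp: dist_eq)
    then show ?thesis using g xs xyz m_ge by (auto simp: generator_def)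
  qed
  then show ?thesis by (fastforce simp: half_def chains_def)
qed

text \<open>Prefixing a vertex moves all positions by one, hence the sign, and creates one new term:
  deletion of the former first vertex. The hypothesis makes exactly this term vanish.\<close>

lemma bd_shift:
  assumes "\<And>x v y t. v \<in> between x y \<Longrightarrow> b x v = j \<Longrightarrow> g (v # y # t) = 0"
  shows "bd (shift b j g) = - shift b j (bd g)"
proof
  show "bd (shift b j g) xs = (- shift b j (bd g)) xs" for xs
  proof (cases "(b, j, g, xs)" rule: shift.cases)
    case (1 b' j' g' x y t)
    have "bd (\<lambda>s. shift b j g (x # s)) (y # t)
        = bd (\<lambda>s. (if x \<in> V \<and> y \<in> V \<and> b x y = j then 1 else 0) * g s) (y # t)"
      by (rule bd_cong) auto
    then have 2: "bd (\<lambda>s. shift b j g (x # s)) (y # t) = shift b j (bd g) (x # y # t)"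
      by (simp add: bd_scale)
    have "(\<Sum>v\<in>between x y. shift b j g (x # v # y # t)) = 0"
      using assms by (intro sum.neutral) auto
    then have "bd (shift b j g) (x # y # t) = - shift b j (bd g) (x # y # t)"
      by (simp only: bd.simps(1)[of "shift b j g"] 2)
    then show ?thesis using 1 by (simp only: prod.inject fun_Compl_def)
  qed auto
qed

lemma shift_chains:
  assumes "g \<in> chains k l" "0 < j" "j \<le> m"
  shows "shift b j g \<in> chains (Suc k) (l + j)"
proof -
  have "generator (Suc k) (l + j) xs" if nz: "shift b j g xs \<noteq> 0" for xs
  proof -
    obtain x y t where xs: "xs = x # y # t"
      using nz by (cases "(b, j, g, xs)" rule: shift.cases) auto
    then have "x \<in> V" "y \<in> V" "b x y = j" "generator k l (y # t)"
      using nz assms by (auto split: if_splits simp: chains_def)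
    then show ?thesis using xs assms arc_0[of x x] by (auto simp: generator_def dist_eq)
  qed
  then show ?thesis by (simp add: chains_def)
qed

lemma some_arc:
  assumes "y \<in> V" "j < 2 * m"
  shows "(SOME x. x \<in> V \<and> b x y = j) \<in> V" "b (SOME x. x \<in> V \<and> b x y = j) y = j"
  using arc_ex'[OF assms] someI[of "\<lambda>x. x \<in> V \<and> b x y = j"] by blast+

lemma unshift_chains:
  assumes "c \<in> chains (Suc k) l" "0 < j" "j \<le> m"
  shows "unshift b j c \<in> chains k (l - j)"
proof -
  have "generator k (l - j) xs" if nz: "unshift b j c xs \<noteq> 0" for xs
  proof -
    obtain y t where xs: "xs = y # t" using nz by (cases xs) auto
    define x where "x = (SOME x. x \<in> V \<and> b x y = j)"
    have y: "y \<in> V" "c (x # y # t) \<noteq> 0" using nz xs by (auto simp: x_def split: if_splits)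
    then have "x \<in> V" "b x y = j" using some_arc[of y j] assms m_ge by (auto simp: x_def)
    moreover have "generator (Suc k) l (x # y # t)" using y assms by (auto simp: chains_def)
    ultimately show ?thesis using xs y assms by (auto simp: generator_def dist_eq)
  qed
  then show ?thesis by (simp add: chains_def)
qed

lemma shift_unshift:
  assumes c: "c \<in> chains (Suc k) l" and j: "0 < j" "j \<le> m"
    and supp: "\<And>x y t. c (x # y # t) \<noteq> 0 \<Longrightarrow> b x y = j"
  shows "shift b j (unshift b j c) = c"
proof
  show "shift b j (unshift b j c) xs = c xs" for xs
  proof (cases "(b, j, c, xs)" rule: shift.cases)
    case (1 b' j' g' x y t)
    show ?thesis
    proof (cases "x \<in> V \<and> y \<in> V \<and> b x y = j")
      case True
      then have "(SOME x. x \<in> V \<and> b x y = j) = x"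
        using some_arc[of y j] j m_ge by (intro arc_unique'[of _ _ y]) auto
      then show ?thesis using 1 True by simp
    next
      case False
      then show ?thesis using 1 supp chains_ConsD[OF c] by fastforce
    qed
  qed (use c in \<open>auto simp: chains_def generator_def\<close>)
qed

lemma unshift_shift:
  assumes "g \<in> chains k l" and j: "0 < j" "j \<le> m"
  shows "unshift b j (shift b j g) = g"
proof
  show "unshift b j (shift b j g) xs = g xs" for xs
  proof (cases xs)
    case Nil
    then show ?thesis using assms(1) by (auto simp: chains_def generator_def)
  next
    case (Cons y t)
    then show ?thesis using some_arc[of y j] j m_ge assms(1)
      by (auto simp: chains_def generator_def)
  qed
qed

section \<open>Acyclicity of a half off the diagonal\<close>

text \<open>All tuples in the support of \<open>homotopy m b c\<close> start with a step of arc 1.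
  If \<open>b x y\<close> is not 1, only insertions into the first gap can reach them, and only at
  the successor of \<open>x\<close>. For \<open>2 \<le> b x y \<le> m\<close> this gives back
  exactly \<open>c (x # y # t)\<close>; beyond \<open>m\<close> everything vanishes.\<close>

lemma homotopy_retract_first:
  assumes c: "c \<in> half m b (Suc k) l" "bd c = 0"
    and nz: "(c - bd (homotopy m b c)) (x # y # t) \<noteq> 0"
  shows "b x y = 1"
proof (rule ccontr)
  assume ne: "b x y \<noteq> 1"
  let ?h = "homotopy m b c"
  have "c - bd ?h \<in> chains (Suc k) l"
    using c(1) homotopy_half half_chains by (blast intro: chains_diff bd_chains)
  from chains_ConsD[OF this nz] have V: "x \<in> V" "y \<in> V" "x \<noteq> y" .
  have "bd (\<lambda>s. ?h (x # s)) (y # t) = bd 0 (y # t)"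
  proof (rule bd_cong)
    show "?h (x # y # s) = 0 (y # s)" for s using ne by (cases s) auto
  qed
  then have bdh: "bd ?h (x # y # t) = - (\<Sum>v\<in>between x y. ?h (x # v # y # t))" by simp
  show False
  proof (cases "b x y \<le> m")
    case True
    then have y2: "2 \<le> b x y" using ne V arc_0[of x y] by linarith
    obtain p where p: "p \<in> V" "b x p = 1" using arc_ex[of x 1] V m_ge by auto
    have "p \<in> between x y" using between_arc[of x y p] p V y2 True m_ge arc_0[of x x] by auto
    moreover have "?h (x # v # y # t) = 0" if "v \<in> between x y - {p}" for v
      using that p V arc_unique[of x v p] by (auto simp: between_def)
    ultimately have "(\<Sum>v\<in>between x y. ?h (x # v # y # t)) = ?h (x # p # y # t)"
      by (subst sum.remove[of _ p]) (auto intro!: sum.neutral)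
    then show False using nz bdh p V y2 True by simp
  next
    case False
    then have "c (x # y # t) = 0" using c by (auto simp: half_def)
    moreover have "(\<Sum>v\<in>between x y. ?h (x # v # y # t)) = 0"
      using False by (intro sum.neutral) auto
    ultimately show False using nz bdh by simp
  qed
qed

text \<open>If the second step continued forward, \<open>y\<close> would lie between
  \<open>x\<close> and \<open>z\<close>. Peeling \<open>x\<close> and \<open>y\<close> off the
  homotopy leaves minus the boundary of \<open>c\<close> with \<open>x\<close> peeled off, which the
  cycle equation at \<open>x # z # r\<close> turns into a sum over vertices between \<open>x\<close>
  and \<open>z\<close>. Insertions between \<open>y\<close> and \<open>z\<close> cancel this sum
  except for the term of \<open>y\<close> itself, so the boundary of the homotopy equals
  \<open>c\<close> at this tuple.\<close>

lemma homotopy_retract_second: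
  assumes c: "c \<in> half m b (Suc k) l" "bd c = 0"
    and nz: "(c - bd (homotopy m b c)) (x # y # z # r) \<noteq> 0"
  shows "b z y \<le> m"
proof (rule ccontr)
  assume gt: "\<not> b z y \<le> m"
  let ?h = "homotopy m b c"
  have ch: "c - bd ?h \<in> chains (Suc k) l"
    using c(1) homotopy_half half_chains by (blast intro: chains_diff bd_chains)
  have "generator (Suc k) l (x # y # z # r)" using ch nz unfolding chains_def by blast
  then have V: "x \<in> V" "y \<in> V" "x \<noteq> y" "z \<in> V" "y \<noteq> z" by (auto simp: generator_def)
  have xy: "b x y = 1" by (rule homotopy_retract_first[OF c nz])
  have yz: "b y z < m" "0 < b y z" using arc_rev[of y z] gt V arc_0[of y z] by auto
  then have xz: "b x z = Suc (b y z)" using arc_add[of x y z] V xy arc_less[of x z] m_ge by auto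
  have empty: "between x y = {}"
  proof -
    have False if "v \<in> between x y" for v
      using that d_eq_0[of x v] d_eq_0[of v y] V xy m_ge by (auto simp: between_def dist_eq[of x y])
    then show ?thesis by blast
  qed
  have "bd (\<lambda>s. ?h (x # y # s)) (z # r) = bd (- (\<lambda>s. c (x # s))) (z # r)"
    by (rule bd_cong) (use V xy xz yz in auto)
  also have "\<dots> = - bd (\<lambda>s. c (x # s)) (z # r)" by (simp add: bd_minus)
  also have "\<dots> = bd c (x # z # r) + (\<Sum>v\<in>between x z. c (x # v # z # r))" by simp
  also have "\<dots> = (\<Sum>v\<in>between x z. c (x # v # z # r))" using c by simp
  finally have 1: "bd (\<lambda>s. ?h (x # y # s)) (z # r) = \<dots>" .
  have "y \<in> between x z" using between_arc[of x z y] V xy xz yz m_ge arc_0[of y z] by auto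
  then have 2: "(\<Sum>v\<in>between x z. c (x # v # z # r))
      = c (x # y # z # r) + (\<Sum>v\<in>between x z - {y}. c (x # v # z # r))"
    by (intro sum.remove) simp_all
  have 3: "(\<Sum>v\<in>between x z - {y}. c (x # v # z # r)) = (\<Sum>v\<in>between y z. - ?h (x # y # v # z # r))"
  proof -
    have iff: "v \<in> between x z - {y} \<longleftrightarrow> v \<in> between y z \<and> 2 \<le> b x v"
      if v: "v \<in> V" "b x v \<le> m" for v
    proof (cases "v = x \<or> v = y \<or> v = z")
      case True
      then show ?thesis using V arc_0[of x x] by (auto simp: between_def)
    next
      case False
      have xv: "b x v = Suc (b y v)"
        using arc_add[of x y v] v V xy arc_less[of y v] False arc_0[of x v] by auto
      have "0 < b y v" using arc_0[of y v] v V False by auto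
      moreover have "v \<in> between x z \<longleftrightarrow> b y v < b y z"
        using between_arc[of x z v] v V False xz yz xv by simp
      moreover have "v \<in> between y z \<longleftrightarrow> b y v < b y z"
        using between_arc[of y z v] v V False yz xv by simp
      ultimately show ?thesis using False xv by auto
    qed
    \<comment> \<open>If \<open>z\<close> is antipodal to \<open>x\<close>, then
      \<open>between x z\<close> also contains the vertices of the backward half circle. The bound
      by \<open>m\<close> discards them, and \<open>c\<close> vanishes there.\<close>
    let ?S = "{v \<in> between x z - {y}. b x v \<le> m}"
    have S: "?S = {v \<in> between y z. 2 \<le> b x v \<and> b x v \<le> m}"
      using iff between_def by blast
    have "(\<Sum>v\<in>between x z - {y}. c (x # v # z # r)) = (\<Sum>v\<in>?S. c (x # v # z # r))"
      using c by (intro sum.mono_neutral_right) (auto simp: half_def)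
    also have "\<dots> = (\<Sum>v\<in>?S. - ?h (x # y # v # z # r))"
      unfolding S using V xy by (intro sum.cong refl) simp
    also have "\<dots> = (\<Sum>v\<in>between y z. - ?h (x # y # v # z # r))"
      unfolding S by (intro sum.mono_neutral_left) auto
    finally show ?thesis .
  qed
  have "bd (\<lambda>s. ?h (x # s)) (y # z # r) = - (\<Sum>v\<in>between y z. ?h (x # y # v # z # r)) - bd (\<lambda>s. ?h (x # y # s)) (z # r)"
    by (simp only: bd.simps)
  also have "\<dots> = - c (x # y # z # r)" using 1 2 3 by (simp add: sum_negf)
  finally have "bd ?h (x # y # z # r) = - 0 - (- c (x # y # z # r))"
    by (simp only: bd.simps(1)[of ?h x y] empty sum.empty)
  then show False using nz by simp
qed

text \<open>A step of length \<open>m\<close> cannot be the initial piece of a longer geodesic, so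
  its end is never deleted.\<close>

lemma bd_shift_antipode:
  shows "bd (shift b m g) = - shift b m (bd g)"
proof (rule bd_shift)
  show "g (v # y # t) = 0" if "v \<in> between x y" "b x v = m" for x v y t
    using that between_arc[of x y v] by (auto simp: between_def)
qed

lemma shift_half:
  assumes "g \<in> chains k l" "0 < j" "j \<le> m"
  shows "shift b j g \<in> half m b (Suc k) (l + j)"
proof -
  have "b x y \<le> m" if "shift b j g (x # y # t) \<noteq> 0" for x y t
    using that assms by (auto split: if_splits)
  then show ?thesis using shift_chains[OF assms] by (auto simp: half_def)
qed

end

text \<open>Subtracting the boundary of the homotopy leaves a prefixed copy of a cycle
  \<open>g\<close> of the opposite half, of degree \<open>k\<close> and length \<open>l - 1\<close>.
  A filling of \<open>g\<close> by the induction hypothesis, prefixed again, completes the filling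
  of \<open>c\<close>.\<close>

lemma half_acyclic:
  assumes "orientation m b" "c \<in> half m b k l" "bd c = 0" "k < l"
  shows "\<exists>w\<in>half m b (Suc k) l. bd w = c"
  using assms
proof (induction k arbitrary: b l c)
  case 0
  have "c xs = 0" for xs
  proof (rule ccontr)
    assume "c xs \<noteq> 0"
    then have "generator 0 l xs" using 0 by (auto simp: half_def chains_def)
    then show False using 0 by (cases xs) (auto simp: generator_def)
  qed
  then have "c = 0" by (auto simp: fun_eq_iff)
  then show ?case using bd_0 half_0 by blast
next
  case (Suc k)
  note or = Suc.prems(1)
  let ?h = "homotopy m b c" and ?rb = "\<lambda>x y. b y x"
  define p where "p = c - bd ?h"
  define g where "g = unshift b 1 p"
  have h: "?h \<in> half m b (Suc (Suc k)) l" using homotopy_half[OF or] Suc.prems by blast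
  have m3: "3 \<le> m" by (rule m_ge[OF or])
  have p: "p \<in> chains (Suc k) l" unfolding p_def
    using Suc.prems(2) h half_chains by (blast intro: chains_diff bd_chains)
  have p1: "b x y = 1" if "p (x # y # t) \<noteq> 0" for x y t
    using homotopy_retract_first[OF or Suc.prems(2,3)] that unfolding p_def by blast
  have p2: "b z y \<le> m" if "p (x # y # z # r) \<noteq> 0" for x y z r
    using homotopy_retract_second[OF or Suc.prems(2,3)] that unfolding p_def by blast
  have pg: "shift b 1 g = p" unfolding g_def
    by (rule shift_unshift[OF or p]) (use p1 m3 in auto)
  have g: "g \<in> chains k (l - 1)" unfolding g_def
    by (rule unshift_chains[OF or p]) (use m3 in auto)
  have "?rb y z \<le> m" if "g (y # z # t) \<noteq> 0" for y z t
    using that p2 unfolding g_def unshift.simps by meson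
  then have gh: "g \<in> half m ?rb k (l - 1)" using g unfolding half_def by blast
  \<comment> \<open>For \<open>v\<close> one step after \<open>x\<close> and between
    \<open>x\<close> and \<open>y\<close>, the way from \<open>v\<close> to \<open>y\<close> is
    forward and shorter than \<open>m\<close>. A chain of the opposite half has no such first step,
    so no new term arises.\<close>
  have shift_bd: "bd (shift b 1 e) = - shift b 1 (bd e)" if e: "e \<in> half m ?rb k' l'" for e k' l'
  proof (rule bd_shift[OF or])
    show "e (v # y # t) = 0" if v: "v \<in> between x y" "b x v = 1" for x v y t
    proof (rule ccontr)
      assume "e (v # y # t) \<noteq> 0"
      then have yv: "b y v \<le> m" using e by (auto simp: half_def)
      have V: "x \<in> V" "y \<in> V" "v \<in> V" "v \<noteq> y" using v by (auto simp: between_def)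
      have "b x y \<le> m" "1 < b x y" using between_arc[OF or, of x y v] V v m3 by auto
      moreover have "b y v + b v y = 2 * m" using arc_rev[OF or, of y v] V by auto
      ultimately show False using arc_add[OF or, of x v y] V v yv by auto
    qed
  qed
  have "bd p = 0" by (simp only: p_def bd_diff bd_bd Suc.prems(3) diff_self)
  then have sh0: "shift b 1 (bd g) = 0" using shift_bd[OF gh] pg by simp
  \<comment> \<open>Degree 0 is separate: \<open>unshift_shift\<close> applies to chains, and there
    is no chain group below degree 0 to contain \<open>bd g\<close>.\<close>
  have "bd g = 0"
  proof (cases k)
    case 0
    then show ?thesis using g bd_chains_0 by blast
  next
    case (Suc k')
    then have "bd g \<in> chains k' (l - 1)" using g bd_chains by blast
    from unshift_shift[OF or this, of 1] have "bd g = unshift b 1 0" using sh0 m3 by simp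
    then show ?thesis by simp
  qed
  moreover have "k < l - 1" using Suc.prems(4) by simp
  ultimately obtain g' where g': "g' \<in> half m ?rb (Suc k) (l - 1)" "bd g' = g"
    using Suc.IH[OF orientation_rev[OF or] gh] by blast
  have "shift b 1 g' \<in> half m b (Suc (Suc k)) (l - 1 + 1)"
    by (rule shift_half[OF or half_chains[OF g'(1)]]) (use m3 in auto)
  \<comment> \<open>The minus sign compensates for prefixing being a chain map only up to sign: the
    second term contributes \<open>+ p\<close>, which is \<open>c - bd ?h\<close>.\<close>
  then have "?h - shift b 1 g' \<in> half m b (Suc (Suc k)) l"
    using h Suc.prems(4) by (intro half_diff) simp_all
  moreover have "bd (?h - shift b 1 g') = c"
    unfolding bd_diff shift_bd[OF g'(1)] g'(2) pg by (simp add: p_def)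
  ultimately show ?case by blast
qed

section \<open>Mayer--Vietoris and periodicity\<close>

text \<open>Chooses a splitting of a chain over the two halves, giving antipodal first steps to the
  first of them. Any other splitting differs by a chain in the intersection.\<close>

definition restrict_half :: "nat \<Rightarrow> ('a \<Rightarrow> 'a \<Rightarrow> nat) \<Rightarrow> ('a list \<Rightarrow> int) \<Rightarrow> 'a list \<Rightarrow> int" where
  "restrict_half m b c xs = (if \<exists>x y t. xs = x # y # t \<and> b x y \<le> m then c xs else 0)"

text \<open>The connecting homomorphism of Mayer--Vietoris, read through the identification of the
  intersection of the two halves with the shifted complex.\<close>

definition connecting :: "nat \<Rightarrow> ('a \<Rightarrow> 'a \<Rightarrow> nat) \<Rightarrow> ('a list \<Rightarrow> int) \<Rightarrow> 'a list \<Rightarrow> int" where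
  "connecting m b c = unshift b m (bd (restrict_half m b c))"

context
  fixes m :: nat and b :: "'a \<Rightarrow> 'a \<Rightarrow> nat"
  assumes orient: "orientation m b"
begin

lemma restrict_half_mem:
  "c \<in> chains (Suc k) l \<Longrightarrow> restrict_half m b c \<in> half m b (Suc k) l"
  by (auto simp: half_def chains_def restrict_half_def)

lemma restrict_half_compl:
  assumes c: "c \<in> chains (Suc k) l"
  shows "c - restrict_half m b c \<in> half m (\<lambda>x y. b y x) (Suc k) l"
proof -
  have "b y x \<le> m" if "(c - restrict_half m b c) (x # y # t) \<noteq> 0" for x y t
  proof -
    have "c (x # y # t) \<noteq> 0" "\<not> b x y \<le> m" using that by (auto simp: restrict_half_def split: if_splits)
    then show ?thesis using arc_rev[OF orient, of x y] chains_ConsD[OF c, of x y t] by auto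
  qed
  moreover have "c - restrict_half m b c \<in> chains (Suc k) l"
    using c restrict_half_mem[OF c] by (auto intro: chains_diff half_chains)
  ultimately show ?thesis by (auto simp: half_def)
qed

text \<open>The arcs of a step in the two directions add up to \<open>2 * m\<close>, so both are at
  most \<open>m\<close> only if both equal \<open>m\<close>; the step alone then has length
  \<open>m\<close>.\<close>

lemma inter_half:
  assumes "c \<in> half m b (Suc k) l" "c \<in> half m (\<lambda>x y. b y x) (Suc k) l"
  shows "shift b m (unshift b m c) = c" "unshift b m c \<in> chains k (l - m)"
    "l < m \<Longrightarrow> c = 0"
proof -
  have eqm: "b x y = m" if nz: "c (x # y # t) \<noteq> 0" for x y t
  proof -
    have "b x y \<le> m" "b y x \<le> m"
      using assms nz unfolding half_def mem_Collect_eq by blast+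
    moreover note chains_ConsD[OF half_chains[OF assms(1)] nz]
    ultimately show ?thesis using arc_rev[OF orient, of x y] by auto
  qed
  have c: "c \<in> chains (Suc k) l" and m3: "3 \<le> m" using assms half_chains m_ge[OF orient] by auto
  show "shift b m (unshift b m c) = c"
    by (rule shift_unshift[OF orient c]) (use eqm m3 in auto)
  show "unshift b m c \<in> chains k (l - m)"
    by (rule unshift_chains[OF orient c]) (use m3 in auto)
  show "c = 0" if "l < m"
  proof
    show "c xs = 0 xs" for xs
    proof (rule ccontr)
      assume "c xs \<noteq> 0 xs"
      then have nz: "c xs \<noteq> 0" by simp
      then have g: "generator (Suc k) l xs" using c by (auto simp: chains_def)
      then obtain x y t where xs: "xs = x # y # t"
        by (cases xs rule: remdups_adj.cases) (auto simp: generator_def)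
      then have "b x y = m" "x \<in> V" "y \<in> V" using eqm nz g by (auto simp: generator_def)
      then show False using g xs that dist_eq[OF orient, of x y] by (auto simp: generator_def)
    qed
  qed
qed

lemma shift_inter_half:
  assumes "g \<in> chains k l"
  shows "shift b m g \<in> half m b (Suc k) (l + m)" "shift b m g \<in> half m (\<lambda>x y. b y x) (Suc k) (l + m)"
proof -
  have m3: "3 \<le> m" using m_ge[OF orient] .
  show 1: "shift b m g \<in> half m b (Suc k) (l + m)"
    by (rule shift_half[OF orient assms]) (use m3 in auto)
  have "b y x \<le> m" if "shift b m g (x # y # t) \<noteq> 0" for x y t
    using that arc_rev[OF orient, of x y] arc_0[OF orient, of x x] m3 by (cases "x = y") (auto split: if_splits)
  then show "shift b m g \<in> half m (\<lambda>x y. b y x) (Suc k) (l + m)" using 1 by (auto simp: half_def)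
qed

text \<open>For a cycle the boundaries of its two parts are negatives of each other, so each lies in
  both halves.\<close>

lemma bd_restrict_inter:
  assumes "c \<in> cycles (Suc k) l"
  shows "bd (restrict_half m b c) \<in> half m b k l"
    "bd (restrict_half m b c) \<in> half m (\<lambda>x y. b y x) k l"
proof -
  have c: "c \<in> chains (Suc k) l" "bd c = 0" using assms by (auto simp: cycles_def)
  show "bd (restrict_half m b c) \<in> half m b k l"
    using bd_half[OF orient restrict_half_mem[OF c(1)]] .
  have "bd (c - restrict_half m b c) \<in> half m (\<lambda>x y. b y x) k l"
    using bd_half[OF orientation_rev[OF orient] restrict_half_compl[OF c(1)]] .
  then have "0 - bd (c - restrict_half m b c) \<in> half m (\<lambda>x y. b y x) k l"
    by (intro half_diff) (auto simp: half_def)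
  then show "bd (restrict_half m b c) \<in> half m (\<lambda>x y. b y x) k l"
    by (simp add: bd_diff c(2))
qed

text \<open>Exactness at the connecting map: moving \<open>i\<close> from one part to the other
  turns both parts into cycles, and each is filled inside its own acyclic half.\<close>

lemma boundary_if_restrict_boundary:
  assumes c: "c \<in> cycles (Suc k) l" and kl: "Suc k < l"
    and i: "i \<in> half m b (Suc k) l" "i \<in> half m (\<lambda>x y. b y x) (Suc k) l"
      "bd i = bd (restrict_half m b c)"
  shows "c \<in> boundaries (Suc k) l"
proof -
  let ?r = "restrict_half m b c"
  have c': "c \<in> chains (Suc k) l" "bd c = 0" using c by (auto simp: cycles_def)
  obtain w1 where w1: "w1 \<in> half m b (Suc (Suc k)) l" "bd w1 = ?r - i"
    using half_acyclic[OF orient half_diff[OF restrict_half_mem[OF c'(1)] i(1)] _ kl] i(3)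
    by (auto simp: bd_diff)
  obtain w2 where w2: "w2 \<in> half m (\<lambda>x y. b y x) (Suc (Suc k)) l" "bd w2 = c - ?r + i"
    using half_acyclic[OF orientation_rev[OF orient] half_add[OF restrict_half_compl[OF c'(1)] i(2)] _ kl] i(3) c'(2)
    by (auto simp: bd_diff bd_add)
  have "bd (w1 + w2) = c" by (simp add: bd_add w1 w2)
  moreover have "w1 + w2 \<in> chains (Suc (Suc k)) l" using w1 w2 by (auto intro: chains_add half_chains)
  ultimately show ?thesis unfolding boundaries_def by blast
qed

lemma connecting_cycle:
  assumes c: "c \<in> cycles (Suc (Suc k)) l"
  shows "connecting m b c \<in> cycles k (l - m)"
    "shift b m (connecting m b c) = bd (restrict_half m b c)"
proof -
  note I = bd_restrict_inter[OF c]
  show sh: "shift b m (connecting m b c) = bd (restrict_half m b c)"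
    unfolding connecting_def by (rule inter_half(1)[OF I])
  have ch: "connecting m b c \<in> chains k (l - m)"
    unfolding connecting_def by (rule inter_half(2)[OF I])
  have "bd (connecting m b c) = 0"
  proof (cases k)
    case 0
    then show ?thesis using ch bd_chains_0 by blast
  next
    case (Suc k')
    have "shift b m (bd (connecting m b c)) = - bd (shift b m (connecting m b c))"
      using bd_shift_antipode[OF orient] by simp
    also have "\<dots> = 0" by (simp add: sh bd_bd)
    finally have "unshift b m (shift b m (bd (connecting m b c))) = 0" by simp
    then show ?thesis
      using unshift_shift[OF orient bd_chains[of _ k' "l - m"], of "connecting m b c" m] ch Suc m_ge[OF orient]
      by simp
  qed
  then show "connecting m b c \<in> cycles k (l - m)" using ch by (simp add: cycles_def)
qed

lemma connecting_boundary_iff: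
  assumes c: "c \<in> cycles (Suc (Suc k)) l" and kl: "Suc (Suc k) < l" "m \<le> l"
  shows "connecting m b c \<in> boundaries k (l - m) \<longleftrightarrow> c \<in> boundaries (Suc (Suc k)) l"
proof
  assume "connecting m b c \<in> boundaries k (l - m)"
  then obtain g where g: "g \<in> chains (Suc k) (l - m)" "connecting m b c = bd g"
    by (auto simp: boundaries_def)
  have "bd (- shift b m g) = bd (restrict_half m b c)"
    using connecting_cycle(2)[OF c] g(2) bd_shift_antipode[OF orient, of g] by (simp add: bd_minus)
  moreover have "- shift b m g \<in> half m b (Suc (Suc k)) l" "- shift b m g \<in> half m (\<lambda>x y. b y x) (Suc (Suc k)) l"
    using shift_inter_half[OF g(1)] kl by (auto intro!: half_minus)
  ultimately show "c \<in> boundaries (Suc (Suc k)) l"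
    using boundary_if_restrict_boundary[OF c kl(1), of "- shift b m g"] by simp
next
  assume "c \<in> boundaries (Suc (Suc k)) l"
  then obtain w where w: "w \<in> chains (Suc (Suc (Suc k))) l" "c = bd w" by (auto simp: boundaries_def)
  let ?w = "restrict_half m b w" and ?r = "restrict_half m b c"
  \<comment> \<open>Restriction does not commute with the boundary; \<open>i\<close> is the defect.
    It lies in both halves, hence is a prefixed chain \<open>g\<close>, and \<open>- g\<close>
    bounds the connecting cycle.\<close>
  define i where "i = ?r - bd ?w"
  have c': "c \<in> chains (Suc (Suc k)) l" using c by (simp add: cycles_def)
  have i1: "i \<in> half m b (Suc (Suc k)) l" unfolding i_def
    using bd_half[OF orient restrict_half_mem[OF w(1)]] restrict_half_mem[OF c'] by (intro half_diff)
  have "i = bd (w - ?w) - (c - ?r)" using w(2) by (simp add: i_def bd_diff)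
  then have i2: "i \<in> half m (\<lambda>x y. b y x) (Suc (Suc k)) l"
    using bd_half[OF orientation_rev[OF orient] restrict_half_compl[OF w(1)]] restrict_half_compl[OF c']
    by (auto intro: half_diff)
  define g where "g = unshift b m i"
  have g: "g \<in> chains (Suc k) (l - m)" "shift b m g = i"
    unfolding g_def using inter_half(1,2)[OF i1 i2] by auto
  have "shift b m (connecting m b c) = bd i"
    using connecting_cycle(2)[OF c] by (simp add: i_def bd_diff bd_bd)
  also have "\<dots> = shift b m (bd (- g))"
  proof -
    have "bd (shift b m (- g)) = - shift b m (bd (- g))" by (rule bd_shift_antipode[OF orient])
    moreover have "shift b m (- g) = - shift b m g"
    proof
      show "shift b m (- g) xs = (- shift b m g) xs" for xs
        by (cases "(b, m, g, xs)" rule: shift.cases) auto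
    qed
    ultimately show ?thesis using g(2) by (simp add: bd_minus)
  qed
  finally have "unshift b m (shift b m (connecting m b c)) = unshift b m (shift b m (bd (- g)))" by simp
  moreover have "connecting m b c \<in> chains k (l - m)" using connecting_cycle[OF c] by (simp add: cycles_def)
  moreover have "- g \<in> chains (Suc k) (l - m)" using g(1) by (rule chains_minus)
  ultimately have "connecting m b c = bd (- g)"
    using unshift_shift[OF orient, of _ k "l - m" m] m_ge[OF orient] bd_chains[of "- g" k "l - m"] by simp
  then show "connecting m b c \<in> boundaries k (l - m)"
    using \<open>- g \<in> chains (Suc k) (l - m)\<close> by (auto simp: boundaries_def)
qed

text \<open>A suspension: the prefixed cycle is filled once in each half, and the difference of the
  two fillings is the required cycle.\<close>

lemma connecting_onto:
  assumes y: "y \<in> cycles k (l - m)" and kl: "Suc (Suc k) < l" "m \<le> l"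
  shows "\<exists>c\<in>cycles (Suc (Suc k)) l. connecting m b c - y \<in> boundaries k (l - m)"
proof -
  have y': "y \<in> chains k (l - m)" "bd y = 0" using y by (auto simp: cycles_def)
  let ?i = "shift b m y"
  have i: "?i \<in> half m b (Suc k) l" "?i \<in> half m (\<lambda>x y. b y x) (Suc k) l"
    using shift_inter_half[OF y'(1)] kl by auto
  have "shift b m 0 = (0 :: 'a list \<Rightarrow> int)"
  proof
    show "shift b m 0 xs = (0 :: 'a list \<Rightarrow> int) xs" for xs
      by (cases "(b, m, y, xs)" rule: shift.cases) auto
  qed
  then have bdi: "bd ?i = 0" using bd_shift_antipode[OF orient, of y] y'(2) by simp
  obtain u1 where u1: "u1 \<in> half m b (Suc (Suc k)) l" "bd u1 = ?i"
    using half_acyclic[OF orient i(1) bdi] kl by auto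
  obtain u2 where u2: "u2 \<in> half m (\<lambda>x y. b y x) (Suc (Suc k)) l" "bd u2 = ?i"
    using half_acyclic[OF orientation_rev[OF orient] i(2) bdi] kl by auto
  define c where "c = u1 - u2"
  have c: "c \<in> chains (Suc (Suc k)) l" "bd c = 0"
    using u1 u2 by (auto simp: c_def bd_diff intro: chains_diff half_chains)
  then have cc: "c \<in> cycles (Suc (Suc k)) l" by (simp add: cycles_def)
  let ?r = "restrict_half m b c"
  \<comment> \<open>The part selected by \<open>restrict_half\<close> need not be \<open>u1\<close>.
    The difference \<open>e\<close> lies in both halves, so it alters the connecting image only by a
    boundary.\<close>
  define e where "e = ?r - u1"
  have e1: "e \<in> half m b (Suc (Suc k)) l" unfolding e_def
    using restrict_half_mem[OF c(1)] u1 by (intro half_diff)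
  have "e = 0 - u2 - (c - ?r)" by (simp add: e_def c_def)
  moreover have "0 - u2 \<in> half m (\<lambda>x y. b y x) (Suc (Suc k)) l"
    using u2(1) by (intro half_diff) (auto simp: half_def)
  ultimately have e2: "e \<in> half m (\<lambda>x y. b y x) (Suc (Suc k)) l"
    using half_diff restrict_half_compl[OF c(1)] by metis
  define g where "g = unshift b m e"
  have g: "g \<in> chains (Suc k) (l - m)" "shift b m g = e"
    unfolding g_def using inter_half(1,2)[OF e1 e2] by auto
  have m3: "3 \<le> m" using m_ge[OF orient] .
  have "bd ?r = ?i + bd e" using u1 by (simp add: e_def bd_diff)
  also have "\<dots> = ?i - shift b m (bd g)" using bd_shift_antipode[OF orient, of g] g(2) by simp
  finally have "connecting m b c = unshift b m ?i - unshift b m (shift b m (bd g))"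
    by (simp add: connecting_def unshift_diff)
  also have "\<dots> = y - bd g"
    using unshift_shift[OF orient, of _ k "l - m" m] y'(1) bd_chains[OF g(1)] m3 by simp
  finally have "connecting m b c - y = bd (- g)" by (simp add: bd_minus)
  then show ?thesis using cc chains_minus[OF g(1)] by (auto simp: boundaries_def)
qed

lemma linear_connecting: "linear_on Z (connecting m b)"
proof -
  have r1: "restrict_half m b (c + e) = restrict_half m b c + restrict_half m b e"
    and r2: "restrict_half m b (\<lambda>x. n * c x) = (\<lambda>x. n * restrict_half m b c x)" for c e n
    by (auto simp: restrict_half_def fun_eq_iff)
  have u1: "unshift b m (c + e) = unshift b m c + unshift b m e" for c e
  proof
    show "unshift b m (c + e) xs = (unshift b m c + unshift b m e) xs" for xs
      by (cases xs) auto
  qed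
  have u2: "unshift b m (\<lambda>x. n * c x) = (\<lambda>x. n * unshift b m c x)" for c n
  proof
    show "unshift b m (\<lambda>x. n * c x) xs = n * unshift b m c xs" for xs
      by (cases xs) auto
  qed
  show ?thesis unfolding linear_on_def connecting_def by (simp add: r1 r2 u1 u2 bd_add bd_scale)
qed

theorem free_quotient_on_periodic:
  assumes "free_quotient_on (cycles k (l - m)) (boundaries k (l - m)) A" "Suc (Suc k) < l" "m \<le> l"
  shows "free_quotient_on (cycles (Suc (Suc k)) l) (boundaries (Suc (Suc k)) l) A"
  by (rule free_quotient_on_transport[OF assms(1) linear_connecting])
    (use connecting_cycle(1) connecting_boundary_iff connecting_onto boundaries_subset_cycles assms in auto)

text \<open>These are the cases in which the target \<open>(k - 2, l - m)\<close> has a negative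
  entry. For \<open>k = 1\<close> the boundary of the restricted part is a chain of degree 0 and
  positive length, hence zero; for larger \<open>k\<close> an antipodal step would already exceed
  the length \<open>l\<close>.\<close>

lemma cycles_eq_boundaries:
  assumes "k < l" "k \<le> 1 \<or> l < m"
  shows "cycles k l = boundaries k l"
proof
  show "cycles k l \<subseteq> boundaries k l"
  proof
    fix c assume c: "c \<in> cycles k l"
    show "c \<in> boundaries k l"
    proof (cases k)
      case 0
      then have "c \<in> half m b k l" "bd c = 0" using c by (auto simp: cycles_def half_def chains_def generator_def)
      then show ?thesis using half_acyclic[OF orient _ _ assms(1)] half_chains
        by (fastforce simp: boundaries_def)
    next
      case (Suc k')
      have "bd (restrict_half m b c) = 0"
      proof (cases k')
        case 0
        then have "bd (restrict_half m b c) \<in> half m b 0 l" using bd_restrict_inter(1)[of c 0 l] c Suc by simp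
        then have *: "bd (restrict_half m b c) xs \<noteq> 0 \<Longrightarrow> generator 0 l xs" for xs
          by (auto simp: half_def chains_def)
        have "\<not> generator 0 l xs" for xs using assms(1) by (cases xs) (auto simp: generator_def)
        then show ?thesis using * by (auto simp: fun_eq_iff)
      next
        case (Suc k'')
        then show ?thesis using inter_half(3)[OF bd_restrict_inter[of c k' l, unfolded Suc]] c assms \<open>k = Suc k'\<close> by auto
      qed
      then show ?thesis
        using boundary_if_restrict_boundary[of c k' l 0] c Suc assms by (auto simp: half_def)
    qed
  qed
qed (rule boundaries_subset_cycles)

end

section \<open>Homology on the diagonal\<close>

fun alternating :: "nat \<Rightarrow> 'a \<Rightarrow> 'a \<Rightarrow> 'a list" where
  "alternating 0 x y = [x]"
| "alternating (Suc k) x y = x # alternating k y x"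

definition edges :: "('a \<times> 'a) set" where
  "edges = (SIGMA x:V. {y \<in> V. d x y = 1})"

definition alternating_walks :: "nat \<Rightarrow> 'a list set" where
  "alternating_walks k = (\<lambda>(x, y). alternating k x y) ` edges"

lemma alternating_walksI: "(x, y) \<in> edges \<Longrightarrow> alternating k x y \<in> alternating_walks k"
  unfolding alternating_walks_def by (rule image_eqI[of _ _ "(x, y)"]) auto

lemma alternating_walksE:
  assumes "xs \<in> alternating_walks k"
  obtains x y where "(x, y) \<in> edges" "xs = alternating k x y"
  using assms unfolding alternating_walks_def by auto

lemma alternating_Cons: "\<exists>t. alternating k x y = x # t"
  by (cases k) auto

lemma alternating_generator:
  "x \<in> V \<Longrightarrow> y \<in> V \<Longrightarrow> d x y = 1 \<Longrightarrow> d y x = 1 \<Longrightarrow> generator k k (alternating k x y)"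
proof (induction k arbitrary: x y)
  case (Suc k)
  obtain t where t: "alternating k y x = y # t" using alternating_Cons by blast
  have "generator k k (y # t)" using Suc.IH[of y x] Suc.prems t by simp
  then show ?case using Suc.prems t d_eq_0[of x y] by (auto simp: generator_def)
qed (auto simp: generator_def)

text \<open>A deletable vertex would lie strictly between \<open>x\<close> and \<open>x\<close>, but
  \<open>d x x\<close> is 0. So each alternating walk is a cycle by itself.\<close>

lemma not_insertion_alternating: "\<not> insertion ys (alternating k x y)"
proof (induction k arbitrary: ys x y)
  case 0
  then show ?case using insertion_length[of ys "[x]"] by auto
next
  case (Suc k)
  show ?case
  proof
    assume "insertion ys (alternating (Suc k) x y)"
    then show False
    proof cases
      case (1 v a z t)
      then have "alternating k y x = v # z # t" "a = x" by auto
      then have "z = x" by (cases k) (use alternating_Cons[of "k - 1" x y] in auto)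
      then show False using 1 \<open>a = x\<close> d_eq_0[of x v] d_eq_0[of x x] by (auto simp: between_def)
    next
      case (2 z t s a)
      then show False using Suc.IH[of "z # t" y x] by auto
    qed
  qed
qed

lemma generator_diagonal_Cons:
  assumes "generator (Suc k) (Suc k) (x # y # t)"
  shows "generator k k (y # t)" "d x y = 1"
proof -
  have "0 < d x y" using assms d_eq_0[of x y] by (auto simp: generator_def)
  moreover have "length (y # t) \<le> Suc (len (y # t))" using assms by (intro le_len) (auto simp: generator_def)
  ultimately show "generator k k (y # t)" "d x y = 1" using assms by (auto simp: generator_def)
qed

context
  fixes m :: nat and b :: "'a \<Rightarrow> 'a \<Rightarrow> nat"
  assumes orient: "orientation m b"
begin

lemma dist_1_iff: "x \<in> V \<Longrightarrow> y \<in> V \<Longrightarrow> d x y = 1 \<longleftrightarrow> b x y = 1 \<or> b x y + 1 = 2 * m"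
  using dist_eq[OF orient, of x y] m_ge[OF orient] arc_less[OF orient, of x y] by auto

lemma dist_1_sym: "x \<in> V \<Longrightarrow> y \<in> V \<Longrightarrow> d x y = 1 \<Longrightarrow> d y x = 1"
  using arc_dist[OF orient, of x y] arc_dist[OF orient, of y x] by (simp add: min.commute)

text \<open>As \<open>x \<noteq> z\<close>, both steps go the same way and \<open>z\<close> lies at
  arc \<open>2\<close> or \<open>2 * m - 2\<close>. For \<open>m \<ge> 3\<close> these differ, so
  \<open>z\<close> determines the direction and thereby the midpoint; in a 4-cycle there would be
  two midpoints.\<close>

lemma between_two_steps:
  assumes V: "x \<in> V" "v \<in> V" "z \<in> V" and d: "d x v = 1" "d v z = 1" "x \<noteq> z"
  shows "between x z = {v}" "d x z = 2"
proof -
  note m3 = m_ge[OF orient]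
  have two: "b x w = 1 \<and> b x z = 2 \<or> b x w + 1 = 2 * m \<and> b x z + 2 = 2 * m"
    if w: "w \<in> V" "d x w = 1" "d w z = 1" for w
  proof -
    have "b x w = 1 \<or> b x w + 1 = 2 * m" "b w z = 1 \<or> b w z + 1 = 2 * m"
      using w V dist_1_iff by blast+
    moreover have "b x z \<noteq> 0" "b x z < 2 * m"
      using V d(3) arc_0[OF orient, of x z] arc_less[OF orient, of x z] by auto
    moreover have "b x w + b w z = b x z \<or> b x w + b w z = b x z + 2 * m"
      using arc_add[OF orient, of x w z] w V by blast
    ultimately show ?thesis using m3 by arith
  qed
  show d2: "d x z = 2" using two[OF V(2) d(1,2)] m3 dist_eq[OF orient, of x z] V by auto
  have "w = v" if "w \<in> between x z" for w
  proof -
    have w: "w \<in> V" "d x w + d w z = 2" "w \<noteq> x" "w \<noteq> z" using that d2 by (auto simp: between_def)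
    then have "d x w = 1" "d w z = 1" using d_eq_0[of x w] d_eq_0[of w z] V by auto
    then have "b x w = b x v" using two[OF w(1)] two[OF V(2) d(1,2)] m3 by arith
    then show ?thesis using arc_unique[OF orient, of x w v] w V by auto
  qed
  moreover have "v \<in> between x z" using V d d2 d_eq_0[of x x] d_eq_0[of v v] by (auto simp: between_def)
  ultimately show "between x z = {v}" by blast
qed

text \<open>On the diagonal every step has length 1. If \<open>z \<noteq> x\<close>, no tuple of the
  support starts with the step from \<open>x\<close> to \<open>z\<close> of length 2, so the
  boundary at \<open>x # z # r\<close> reduces to the single term
  \<open>- c (x # v # z # r)\<close>.\<close>

lemma diagonal_cycle_turns_back:
  assumes c: "c \<in> chains (Suc (Suc k)) (Suc (Suc k))" "bd c = 0" and nz: "c (x # v # z # r) \<noteq> 0"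
  shows "z = x"
proof (rule ccontr)
  assume ne: "z \<noteq> x"
  have g: "generator (Suc (Suc k)) (Suc (Suc k)) (x # v # z # r)" using c(1) nz unfolding chains_def by blast
  then have V: "x \<in> V" "v \<in> V" "z \<in> V" by (auto simp: generator_def)
  have d: "d x v = 1" "d v z = 1"
    using generator_diagonal_Cons(2)[OF g] generator_diagonal_Cons(2)[OF generator_diagonal_Cons(1)[OF g]] .
  note two = between_two_steps[OF V d ne[symmetric]]
  have "c (x # z # s) = 0" for s
  proof (rule ccontr)
    assume "c (x # z # s) \<noteq> 0"
    then have "generator (Suc (Suc k)) (Suc (Suc k)) (x # z # s)" using c(1) unfolding chains_def by blast
    then show False using generator_diagonal_Cons(2) two(2) by fastforce
  qed
  then have "bd (\<lambda>t. c (x # t)) (z # r) = bd 0 (z # r)" by (intro bd_cong) simp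
  then have "bd c (x # z # r) = - c (x # v # z # r)" using two(1) by simp
  then show False using c(2) nz by simp
qed

text \<open>Turning back kills all insertions into the first gap, so fixing the first vertex of a
  diagonal cycle yields a diagonal cycle one degree lower, to which induction applies.\<close>

lemma diagonal_cycle_alternating:
  assumes "c \<in> chains k k" "bd c = 0" "c xs \<noteq> 0"
  shows "xs \<in> alternating_walks k"
  using assms
proof (induction k arbitrary: c xs)
  case 0
  then have "generator 0 0 xs" unfolding chains_def by blast
  then obtain x where x: "xs = [x]" "x \<in> V" by (cases xs) (auto simp: generator_def)
  obtain y where y: "y \<in> V" "b x y = 1" using arc_ex[OF orient, of x 1] x m_ge[OF orient] by auto
  then have "(x, y) \<in> edges" using x dist_1_iff by (auto simp: edges_def)
  then show ?case using x alternating_walksI[of x y 0] by simp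
next
  case (Suc k)
  have g: "generator (Suc k) (Suc k) xs" using Suc.prems(1,3) unfolding chains_def by blast
  then obtain x y t where xs: "xs = x # y # t"
    by (cases xs rule: remdups_adj.cases) (auto simp: generator_def)
  define e where "e = (\<lambda>t. c (x # t))"
  have e: "e \<in> chains k k"
    unfolding chains_def mem_Collect_eq
  proof (intro allI impI)
    fix s assume "e s \<noteq> 0"
    then have gs: "generator (Suc k) (Suc k) (x # s)" using Suc.prems(1) unfolding chains_def e_def by blast
    then obtain z r where "s = z # r" by (cases s) (auto simp: generator_def)
    then show "generator k k s" using gs generator_diagonal_Cons(1) by blast
  qed
  have "bd e s = 0" for s
  proof (cases s)
    case (Cons z r)
    have "c (x # v # z # r) = 0" if v: "v \<in> between x z" for v
    proof (rule ccontr)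
      assume nz: "c (x # v # z # r) \<noteq> 0"
      then have "generator (Suc k) (Suc k) (x # v # z # r)" using Suc.prems(1) unfolding chains_def by blast
      then obtain k' where "k = Suc k'" by (cases k) (auto simp: generator_def)
      then have "z = x" using diagonal_cycle_turns_back[OF _ Suc.prems(2) nz] Suc.prems(1) by blast
      then show False using v d_eq_0[of x x] d_eq_0[of x v] by (auto simp: between_def)
    qed
    then have "bd c (x # z # r) = - bd e (z # r)" by (simp add: e_def)
    then show ?thesis using Suc.prems(2) Cons by simp
  qed simp
  then have "bd e = 0" by (auto simp: fun_eq_iff)
  moreover have "e (y # t) \<noteq> 0" using Suc.prems(3) xs by (simp add: e_def)
  ultimately have "y # t \<in> alternating_walks k" using Suc.IH e by blast
  then obtain y' w where w': "(y', w) \<in> edges" "y # t = alternating k y' w"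
    by (rule alternating_walksE)
  then have w: "y # t = alternating k y w" using alternating_Cons[of k y' w] by auto
  have xy: "x \<in> V" "y \<in> V" "d x y = 1"
    using g[unfolded xs] generator_diagonal_Cons(2)[OF g[unfolded xs]] by (simp_all add: generator_def)
  then have "(x, y) \<in> edges" by (auto simp: edges_def)
  moreover have "xs = alternating (Suc k) x y"
  proof (cases k)
    case 0
    then show ?thesis using xs w by simp
  next
    case k': (Suc k')
    then obtain r where "t = w # r" using w alternating_Cons[of k' w y] by auto
    then have "c (x # y # w # r) \<noteq> 0" using Suc.prems(3) xs by simp
    then have "w = x" using diagonal_cycle_turns_back[OF _ Suc.prems(2)] Suc.prems(1) k' by blast
    then show ?thesis using xs w by simp
  qed
  ultimately show ?case using alternating_walksI by metis
qed

lemma cycles_diagonal: "cycles k k = {c. \<forall>xs. c xs \<noteq> 0 \<longrightarrow> xs \<in> alternating_walks k}"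
proof (intro set_eqI iffI)
  fix c assume "c \<in> cycles k k"
  then have "c \<in> chains k k" "bd c = 0" by (auto simp: cycles_def)
  from diagonal_cycle_alternating[OF this]
  show "c \<in> {c. \<forall>xs. c xs \<noteq> 0 \<longrightarrow> xs \<in> alternating_walks k}" by simp
next
  fix c :: "'a list \<Rightarrow> int" assume "c \<in> {c. \<forall>xs. c xs \<noteq> 0 \<longrightarrow> xs \<in> alternating_walks k}"
  then have c: "\<And>xs. c xs \<noteq> 0 \<Longrightarrow> xs \<in> alternating_walks k" by blast
  have "generator k k xs" if "xs \<in> alternating_walks k" for xs
  proof -
    obtain x y where "(x, y) \<in> edges" and xs: "xs = alternating k x y"
      using \<open>xs \<in> alternating_walks k\<close> by (rule alternating_walksE)
    then have e: "x \<in> V" "y \<in> V" "d x y = 1" by (auto simp: edges_def)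
    show ?thesis unfolding xs by (rule alternating_generator[OF e dist_1_sym[OF e]])
  qed
  then have "c \<in> chains k k" using c unfolding chains_def by blast
  moreover have "bd c = 0"
  proof
    show "bd c ys = 0 ys" for ys
    proof (rule ccontr)
      assume "bd c ys \<noteq> 0 ys"
      then have "bd c ys \<noteq> 0" by simp
      from bd_nonzero[OF this] obtain xs where ins: "insertion ys xs" "c xs \<noteq> 0" by blast
      from c[OF ins(2)] obtain x y where "xs = alternating k x y" by (rule alternating_walksE)
      then show False using not_insertion_alternating ins(1) by simp
    qed
  qed
  ultimately show "c \<in> cycles k k" by (simp add: cycles_def)
qed

lemma boundaries_diagonal: "boundaries k k = {0}"
  by (simp add: boundaries_def chains_trivial)

lemma card_V:
  assumes "V \<noteq> {}"
  shows "card V = 2 * m"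
proof -
  obtain x where x: "x \<in> V" using assms by blast
  have "inj_on (b x) V" using x arc_unique[OF orient, of x] by (intro inj_onI) blast
  moreover have "b x ` V = {..<2 * m}"
  proof
    show "{..<2 * m} \<subseteq> b x ` V" using arc_ex[OF orient x] by blast
  qed (use x arc_less[OF orient] in blast)
  ultimately show ?thesis by (metis card_image card_lessThan)
qed

lemma card_edges:
  assumes "V \<noteq> {}"
  shows "card edges = 4 * m"
proof -
  have "card {y \<in> V. d x y = 1} = 2" if x: "x \<in> V" for x
  proof -
    obtain p q where pq: "p \<in> V" "b x p = 1" "q \<in> V" "b x q + 1 = 2 * m"
      using arc_ex[OF orient x, of 1] arc_ex[OF orient x, of "2 * m - 1"] m_ge[OF orient] by force
    have "y = p \<or> y = q" if "y \<in> V" "d x y = 1" for y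
      using that pq x dist_1_iff[of x y] arc_unique[OF orient, of x y p] arc_unique[OF orient, of x y q] by auto
    moreover have "d x p = 1" "d x q = 1" using pq x dist_1_iff by blast+
    ultimately have "{y \<in> V. d x y = 1} = {p, q}" using pq by blast
    moreover have "p \<noteq> q" using pq m_ge[OF orient] by auto
    ultimately show ?thesis by simp
  qed
  then show ?thesis using card_V[OF assms] finite_V by (simp add: edges_def)
qed

text \<open>In positive degree the first two vertices recover the directed edge, of which there are
  \<open>4 * m\<close>; in degree 0 the second vertex is lost and only the \<open>2 * m\<close>
  vertices remain. This is the origin of the two initial values of \<open>T_fun\<close>.\<close>

lemma card_alternating_walks:
  assumes "V \<noteq> {}"
  shows "finite (alternating_walks k)" "card (alternating_walks k) = (if k = 0 then 2 * m else 4 * m)"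
proof -
  have "finite edges" unfolding edges_def using finite_V by (intro finite_SigmaI) auto
  then show "finite (alternating_walks k)" by (simp add: alternating_walks_def)
  show "card (alternating_walks k) = (if k = 0 then 2 * m else 4 * m)"
  proof (cases k)
    case 0
    have "alternating_walks 0 = (\<lambda>x. [x]) ` V"
    proof (intro set_eqI iffI)
      fix xs assume "xs \<in> (\<lambda>x. [x]) ` V"
      then obtain x where x: "xs = [x]" "x \<in> V" by blast
      obtain y where "y \<in> V" "b x y = 1" using arc_ex[OF orient, of x 1] x m_ge[OF orient] by auto
      then have "(x, y) \<in> edges" using x dist_1_iff by (auto simp: edges_def)
      then show "xs \<in> alternating_walks 0" using x alternating_walksI[of x y 0] by simp
    qed (auto elim!: alternating_walksE simp: edges_def)
    moreover have "inj_on (\<lambda>x. [x]) V" by (simp add: inj_on_def)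
    ultimately show ?thesis using 0 card_V[OF assms] by (simp add: card_image)
  next
    case (Suc k')
    have eq: "x = x' \<and> y = y'" if "alternating k x y = alternating k x' y'" for x y x' y'
    proof -
      obtain t t' where "alternating k' y x = y # t" "alternating k' y' x' = y' # t'"
        using alternating_Cons by meson
      then show ?thesis using that unfolding Suc by simp
    qed
    have "inj_on (\<lambda>(x, y). alternating k x y) edges"
      by (intro inj_onI) (use eq in \<open>auto split: prod.splits\<close>)
    then show ?thesis using Suc card_edges[OF assms] by (simp add: alternating_walks_def card_image)
  qed
qed

end

end

lemma free_quotient_on_id: "free_quotient_on {c. \<forall>x. c x \<noteq> 0 \<longrightarrow> x \<in> A} {0} A"
  unfolding free_quotient_on_def linear_on_def by (intro exI[of _ "\<lambda>c. c"]) simp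

section \<open>The recursion for the ranks\<close>

declare T_fun.simps [simp del]

lemma T_fun_neg: "k < 0 \<or> l < 0 \<Longrightarrow> T_fun m k l = 0"
  by (subst T_fun.simps) simp

lemma T_fun_rec:
  assumes "0 \<le> k" "0 \<le> l" "(k, l) \<noteq> (0, 0)" "(k, l) \<noteq> (1, 1)"
  shows "T_fun m k l = max (T_fun m (k - 1) (l - 1)) (T_fun m (k - 2) (l - m))"
  using assms by (subst T_fun.simps) auto

lemma T_fun_nonneg: "0 \<le> m \<Longrightarrow> 0 \<le> T_fun m k l"
proof (induction m k l rule: T_fun.induct)
  case (1 m k l)
  then show ?case by (subst T_fun.simps) (auto simp: le_max_iff_disj)
qed

text \<open>Both recursive calls stay strictly above the diagonal, since \<open>m \<ge> 2\<close>,
  and the nonzero initial values lie on it.\<close>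

lemma T_fun_above:
  assumes "2 \<le> m" "l < k"
  shows "T_fun m k l = 0"
  using assms
proof (induction m k l rule: T_fun.induct)
  case (1 m k l)
  show ?case
  proof (cases "k < 0 \<or> l < 0")
    case False
    then have "T_fun m (k - 1) (l - 1) = 0" "T_fun m (k - 2) (l - m) = 0" using 1 by auto
    then show ?thesis using False 1 by (subst T_fun_rec) auto
  qed (rule T_fun_neg)
qed

lemma T_fun_diagonal:
  assumes "3 \<le> m"
  shows "T_fun m (int k) (int k) = (if k = 0 then 2 * m else 4 * m)"
proof (induction k)
  case 0
  then show ?case by (subst T_fun.simps) simp
next
  case (Suc k)
  show ?case
  proof (cases "k = 0")
    case True
    then show ?thesis by (subst T_fun.simps) simp
  next
    case False
    then have "T_fun m (int (Suc k)) (int (Suc k))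
        = max (T_fun m (int k) (int k)) (T_fun m (int k - 1) (int (Suc k) - m))"
      by (subst T_fun_rec) auto
    moreover have "T_fun m (int k - 1) (int (Suc k) - m) = 0"
      using assms by (intro T_fun_above) auto
    ultimately show ?thesis using Suc assms False by simp
  qed
qed

text \<open>By induction the first argument of the maximum is
  \<open>T_fun m (k - 3) (l - 1 - m)\<close>, which is itself one of the two arguments in the
  recursion for the second.\<close>

lemma T_fun_below:
  assumes "3 \<le> m" "k < l" "0 \<le> k"
  shows "T_fun m k l = T_fun m (k - 2) (l - m)"
  using assms
proof (induction m k l rule: T_fun.induct)
  case (1 m k l)
  have "T_fun m (k - 1) (l - 1) \<le> T_fun m (k - 2) (l - m)"
  proof (cases "k = 0")
    case True
    then show ?thesis using T_fun_neg[of "k - 1"] T_fun_nonneg 1 by simp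
  next
    case False
    have "T_fun m (k - 1) (l - 1) = T_fun m (k - 3) (l - 1 - m)"
      using 1 False by (simp add: algebra_simps)
    also have "\<dots> \<le> T_fun m (k - 2) (l - m)"
    proof -
      consider "k - 2 < 0 \<or> l - m < 0" | "k - 2 = 0 \<and> l - m = 0" | "k - 2 = 1 \<and> l - m = 1"
        | "0 \<le> k - 2 \<and> 0 \<le> l - m \<and> (k - 2, l - m) \<noteq> (0, 0) \<and> (k - 2, l - m) \<noteq> (1, 1)" by fastforce
      then show ?thesis
      proof cases
        case 1
        then show ?thesis using T_fun_neg[of "k - 3" "l - 1 - m" m] T_fun_nonneg[of m] \<open>3 \<le> m\<close> by auto
      next
        case 2
        then show ?thesis using T_fun_neg[of "k - 3" "l - 1 - m" m] T_fun_nonneg[of m] \<open>3 \<le> m\<close> by auto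
      next
        case 3
        then have eqs: "k - 3 = int 0" "l - 1 - m = int 0" "k - 2 = int 1" "l - m = int 1" by auto
        show ?thesis unfolding eqs T_fun_diagonal[OF \<open>3 \<le> m\<close>] using \<open>3 \<le> m\<close> by simp
      next
        case 4
        then have "T_fun m (k - 2) (l - m) = max (T_fun m (k - 2 - 1) (l - m - 1)) (T_fun m (k - 2 - 2) (l - m - m))"
          by (intro T_fun_rec) auto
        moreover have "k - 2 - 1 = k - 3" "l - m - 1 = l - 1 - m" by auto
        ultimately show ?thesis by simp
      qed
    qed
    finally show ?thesis .
  qed
  moreover have "T_fun m k l = max (T_fun m (k - 1) (l - 1)) (T_fun m (k - 2) (l - m))"
    using 1 by (intro T_fun_rec) auto
  ultimately show ?case by simp
qed

section \<open>Bases in all degrees and lengths\<close>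

context finite_metric
begin

text \<open>Descent by \<open>(2, m)\<close> keeps the index set \<open>A\<close> unchanged until it
  meets the diagonal, where \<open>A\<close> consists of alternating walks, or a pair without
  homology, where it is empty.\<close>

theorem free_quotient_on_T_fun:
  assumes orient: "orientation m b" and V: "V \<noteq> {}"
  shows "\<exists>A :: 'a list set. finite A \<and> free_quotient_on (cycles k l) (boundaries k l) A \<and>
    int (card A) = T_fun (int m) (int k) (int l)"
proof (induction k arbitrary: l rule: less_induct)
  case (less k)
  have m3: "3 \<le> m" by (rule m_ge[OF orient])
  have nonempty: "cycles k l \<noteq> {}" using chains_0 bd_0 unfolding cycles_def by blast
  consider "l < k" | "l = k" | "k < l" "k \<le> 1 \<or> l < m" | "k < l" "2 \<le> k" "m \<le> l" by linarith
  then show ?case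
  proof cases
    case 1
    have "cycles k l \<subseteq> {0}" unfolding cycles_def chains_trivial[OF 1] by blast
    moreover have "boundaries k l = {0}"
      unfolding boundaries_def chains_trivial[OF less_SucI[OF 1]] by simp
    ultimately have "cycles k l = boundaries k l" using nonempty by (metis subset_singletonD)
    note free_quotient_on_trivial[OF this nonempty]
    moreover have "T_fun (int m) (int k) (int l) = 0" using 1 m3 by (intro T_fun_above) simp_all
    ultimately show ?thesis by (intro exI[of _ "{}"]) simp
  next
    case 2
    have "free_quotient_on (cycles k l) (boundaries k l) (alternating_walks k)"
      unfolding 2 cycles_diagonal[OF orient] boundaries_diagonal[OF orient] by (rule free_quotient_on_id)
    moreover have "int (card (alternating_walks k)) = T_fun (int m) (int k) (int l)"
      unfolding 2 card_alternating_walks(2)[OF orient V] using T_fun_diagonal[of "int m" k] m3 by simp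
    ultimately show ?thesis using card_alternating_walks(1)[OF orient V] by blast
  next
    case 3
    have "T_fun (int m) (int k) (int l) = T_fun (int m) (int k - 2) (int l - int m)"
      using 3(1) m3 by (intro T_fun_below) simp_all
    also have "\<dots> = 0" using 3(2) by (intro T_fun_neg) auto
    finally show ?thesis
      using free_quotient_on_trivial[OF cycles_eq_boundaries[OF orient 3] nonempty]
      by (intro exI[of _ "{}"]) simp
  next
    case 4
    then obtain k' where k': "k = Suc (Suc k')" by (metis add_2_eq_Suc le_Suc_ex)
    then obtain A :: "'a list set" where A: "finite A"
        "free_quotient_on (cycles k' (l - m)) (boundaries k' (l - m)) A"
        "int (card A) = T_fun (int m) (int k') (int (l - m))"
      using less.IH[of k' "l - m"] by (meson less_Suc_eq)
    have "T_fun (int m) (int k) (int l) = T_fun (int m) (int k - 2) (int l - int m)"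
      using 4(1) m3 by (intro T_fun_below) simp_all
    also have "int k - 2 = int k'" using k' by simp
    also have "int l - int m = int (l - m)" using 4(3) by simp
    finally have "int (card A) = T_fun (int m) (int k) (int l)" using A(3) by simp
    moreover have "free_quotient_on (cycles k l) (boundaries k l) A"
      unfolding k' by (rule free_quotient_on_periodic[OF orient A(2)]) (use 4 k' in simp_all)
    ultimately show ?thesis using A(1) by blast
  qed
qed

end

section \<open>Rank and torsion from a free quotient\<close>

lemma sum_combination:
  fixes z :: "nat \<Rightarrow> 'b \<Rightarrow> int" and a :: "nat \<Rightarrow> int"
  assumes lin: "linear_on Z \<Phi>" and zero: "0 \<in> Z"
    and add: "\<And>c e. c \<in> Z \<Longrightarrow> e \<in> Z \<Longrightarrow> c + e \<in> Z"
    and scale: "\<And>c n. c \<in> Z \<Longrightarrow> (\<lambda>x. n * c x) \<in> Z"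
    and z: "\<And>i. i < r \<Longrightarrow> z i \<in> Z"
  shows "(\<lambda>x. \<Sum>i<r. a i * z i x) \<in> Z \<and>
    \<Phi> (\<lambda>x. \<Sum>i<r. a i * z i x) = (\<lambda>x. \<Sum>i<r. a i * \<Phi> (z i) x)"
  using z
proof (induction r)
  case 0
  have "\<Phi> (\<lambda>x. 0 * (0 :: 'b \<Rightarrow> int) x) = (\<lambda>x. 0 * \<Phi> 0 x)" by (rule linear_onD(2)[OF lin zero])
  then show ?case using zero by (simp add: zero_fun_def)
next
  case (Suc r)
  let ?s = "\<lambda>x. \<Sum>i<r. a i * z i x" and ?e = "\<lambda>x. a r * z r x"
  have IH: "?s \<in> Z" "\<Phi> ?s = (\<lambda>x. \<Sum>i<r. a i * \<Phi> (z i) x)" using Suc by simp_all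
  have zr: "z r \<in> Z" using Suc.prems by simp
  have eq: "(\<lambda>x. \<Sum>i<Suc r. a i * z i x) = ?s + ?e" by (simp add: plus_fun_def)
  have "\<Phi> (?s + ?e) = \<Phi> ?s + \<Phi> ?e" by (rule linear_onD(1)[OF lin IH(1) scale[OF zr]])
  also have "\<Phi> ?e = (\<lambda>x. a r * \<Phi> (z r) x)" by (rule linear_onD(2)[OF lin zr])
  finally show ?case unfolding eq IH(2) using add[OF IH(1) scale[OF zr]] by (simp add: plus_fun_def)
qed

text \<open>Torsion-freeness is inherited from integer functions, where a nonzero multiple vanishes
  only if the function does. More than \<open>card A\<close> classes are dependent by elimination;
  fewer can be realised by lifting unit vectors.\<close>

lemma free_quotient_on_mh:
  assumes fr: "free_quotient_on (mh_cycles V d k l) (mh_boundaries V d k l) A" and fin: "finite A"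
    and zero: "0 \<in> mh_cycles V d k l"
    and add: "\<And>c e. c \<in> mh_cycles V d k l \<Longrightarrow> e \<in> mh_cycles V d k l \<Longrightarrow> c + e \<in> mh_cycles V d k l"
    and scale: "\<And>c n. c \<in> mh_cycles V d k l \<Longrightarrow> (\<lambda>x. n * c x) \<in> mh_cycles V d k l"
  shows "mh_torsion_free V d k l" "mh_rank V d k l = card A"
proof -
  let ?Z = "mh_cycles V d k l" and ?B = "mh_boundaries V d k l"
  obtain \<Phi> where lin: "linear_on ?Z \<Phi>" and supp: "\<forall>c\<in>?Z. \<forall>x. \<Phi> c x \<noteq> 0 \<longrightarrow> x \<in> A"
    and ker': "\<forall>c\<in>?Z. \<Phi> c = 0 \<longleftrightarrow> c \<in> ?B"
    and onto: "\<forall>g. (\<forall>x. g x \<noteq> 0 \<longrightarrow> x \<in> A) \<longrightarrow> (\<exists>c\<in>?Z. \<Phi> c = g)"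
    using fr unfolding free_quotient_on_def by blast
  note ker = ker'[rule_format]
  show "mh_torsion_free V d k l"
    unfolding mh_torsion_free_def
  proof (intro ballI allI impI, elim conjE)
    fix c and n :: int
    assume c: "c \<in> ?Z" and n: "n \<noteq> 0" "(\<lambda>xs. n * c xs) \<in> ?B"
    have "\<Phi> (\<lambda>xs. n * c xs) = 0" using n(2) ker[OF scale[OF c]] by blast
    then have "(\<lambda>x. n * \<Phi> c x) = 0" unfolding linear_onD(2)[OF lin c] .
    then have "\<Phi> c = 0" using n(1) by (simp add: fun_eq_iff)
    then show "c \<in> ?B" using ker[OF c] by blast
  qed
  have comb: "(\<lambda>x. \<Sum>i<r. a i * z i x) \<in> ?Z"
      "\<Phi> (\<lambda>x. \<Sum>i<r. a i * z i x) = (\<lambda>x. \<Sum>i<r. a i * \<Phi> (z i) x)"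
    if "\<forall>i<r. z i \<in> ?Z" for r :: nat and z a
  proof -
    have "(\<lambda>x. \<Sum>i<r. a i * z i x) \<in> ?Z \<and>
        \<Phi> (\<lambda>x. \<Sum>i<r. a i * z i x) = (\<lambda>x. \<Sum>i<r. a i * \<Phi> (z i) x)"
    proof (rule sum_combination[OF lin zero])
      show "c + e \<in> ?Z" if "c \<in> ?Z" "e \<in> ?Z" for c e using that by (rule add)
      show "(\<lambda>x. n * c x) \<in> ?Z" if "c \<in> ?Z" for c n using that by (rule scale)
    qed (use that in simp)
    then show "(\<lambda>x. \<Sum>i<r. a i * z i x) \<in> ?Z"
      "\<Phi> (\<lambda>x. \<Sum>i<r. a i * z i x) = (\<lambda>x. \<Sum>i<r. a i * \<Phi> (z i) x)" by (rule conjunct1, rule conjunct2)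
  qed
  have "mh_indep V d k l r \<longleftrightarrow> r \<le> card A" for r
  proof
    assume "mh_indep V d k l r"
    then obtain z where z: "\<forall>i<r. z i \<in> ?Z"
      and ind: "\<forall>a. (\<lambda>xs. \<Sum>i<r. a i * z i xs) \<in> ?B \<longrightarrow> (\<forall>i<r. a i = 0)"
      unfolding mh_indep_def by blast
    show "r \<le> card A"
    proof (rule ccontr)
      assume "\<not> r \<le> card A"
      then have "card A < card {..<r}" by simp
      moreover have "x \<in> A" if "i \<in> {..<r}" "\<Phi> (z i) x \<noteq> 0" for i x
        using supp z that by blast
      ultimately have "\<exists>a. (\<exists>i\<in>{..<r}. a i \<noteq> 0) \<and> (\<forall>x. (\<Sum>i<r. a i * \<Phi> (z i) x) = (0::int))"
        by (rule int_vectors_dependent[OF fin finite_lessThan])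
      then obtain a where a: "\<exists>i\<in>{..<r}. a i \<noteq> 0" "\<forall>x. (\<Sum>i<r. a i * \<Phi> (z i) x) = (0::int)"
        by blast
      have "\<Phi> (\<lambda>x. \<Sum>i<r. a i * z i x) = 0"
        unfolding comb(2)[OF z] using a(2) by (simp add: fun_eq_iff)
      then have "(\<lambda>x. \<Sum>i<r. a i * z i x) \<in> ?B" using ker[OF comb(1)[OF z]] by simp
      then show False using ind[rule_format, of a] a(1) by simp
    qed
  next
    assume "r \<le> card A"
    then have "card {..<r} \<le> card A" by simp
    then obtain f where f: "f ` {..<r} \<subseteq> A" "inj_on f {..<r}"
      using card_le_inj[OF finite_lessThan fin] by blast
    \<comment> \<open>Cycles lying over the unit vectors at distinct points of \<open>A\<close>;
      evaluating a relation at \<open>f j\<close> isolates its coefficient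
      \<open>a j\<close>.\<close>
    have "\<exists>c\<in>?Z. \<Phi> c = (\<lambda>x. if x = f i then 1 else 0)" if "i < r" for i
      using f(1) that by (intro onto[rule_format]) (auto split: if_splits)
    then have "\<forall>i\<in>{..<r}. \<exists>c. c \<in> ?Z \<and> \<Phi> c = (\<lambda>x. if x = f i then 1 else 0)" by blast
    from bchoice[OF this] obtain z
      where z': "\<forall>i\<in>{..<r}. z i \<in> ?Z \<and> \<Phi> (z i) = (\<lambda>x. if x = f i then 1 else 0)" ..
    have z: "z i \<in> ?Z" "\<Phi> (z i) = (\<lambda>x. if x = f i then 1 else 0)" if "i < r" for i
      using z'[rule_format, of i] that by simp_all
    have "a j = 0" if B: "(\<lambda>xs. \<Sum>i<r. a i * z i xs) \<in> ?B" and j: "j < r" for a j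
    proof -
      have z1: "\<forall>i<r. z i \<in> ?Z" using z(1) by simp
      have "(\<lambda>x. \<Sum>i<r. a i * \<Phi> (z i) x) = 0" using ker[OF comb(1)[OF z1, of a]] B comb(2)[OF z1, of a] by simp
      then have "0 = (\<Sum>i<r. a i * \<Phi> (z i) (f j))" by (simp add: fun_eq_iff)
      also have "\<dots> = (\<Sum>i<r. if i = j then a i else 0)"
        using f(2) j z(2) by (intro sum.cong refl) (auto simp: inj_on_def)
      also have "\<dots> = a j" using j by simp
      finally show ?thesis by simp
    qed
    then show "mh_indep V d k l r" unfolding mh_indep_def using z(1) by (intro exI[of _ z]) simp
  qed
  then show "mh_rank V d k l = card A"
    unfolding mh_rank_def by (intro Greatest_equality) auto
qed

section \<open>Agreement with the complex given by deletions\<close>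

context finite_metric
begin

lemma cycles_0: "0 \<in> cycles k l"
  using chains_0 bd_0 unfolding cycles_def by blast

lemma cycles_add: "c \<in> cycles k l \<Longrightarrow> e \<in> cycles k l \<Longrightarrow> c + e \<in> cycles k l"
  by (simp add: cycles_def chains_add bd_add)

lemma cycles_scale: "c \<in> cycles k l \<Longrightarrow> (\<lambda>x. n * c x) \<in> cycles k l"
  by (simp add: cycles_def chains_def bd_scale fun_eq_iff)

lemma tuple_len_eq: "tuple_len d xs = int (len xs)"
proof (induction xs rule: induct_list012)
  case (3 x y t)
  then show ?case unfolding tuple_len_def by (simp add: sum.lessThan_Suc_shift del: sum.lessThan_Suc)
qed (auto simp: tuple_len_def)

lemma mc_gens_eq: "mc_gens V d (int k) (int l) = {xs. generator k l xs}"
  by (auto simp: mc_gens_def generator_def tuple_len_eq distinct_adj_conv_nth)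

lemma mc_chains_eq: "mc_chains V d (int k) (int l) = chains k l"
  by (simp add: mc_chains_def chains_def mc_gens_eq)

text \<open>Unrolling the recursion: each peeled vertex moves the gap by one position and
  contributes a factor \<open>-1\<close>, which accumulates to \<open>(-1) ^ i\<close>.\<close>

lemma bd_eq_sum_insertions:
  "bd c ys = (\<Sum>i\<in>{1..<length ys}. (-1) ^ i * (\<Sum>v\<in>between (ys ! (i - 1)) (ys ! i). c (take i ys @ v # drop i ys)))"
proof (induction ys arbitrary: c rule: induct_list012)
  case (3 y z r)
  let ?f = "\<lambda>i. (-1) ^ i * (\<Sum>v\<in>between ((y # z # r) ! (i - 1)) ((y # z # r) ! i). c (take i (y # z # r) @ v # drop i (y # z # r)))"
  have "(\<Sum>i\<in>{1..<length (y # z # r)}. ?f i) = ?f 1 + (\<Sum>i\<in>{Suc 1..<Suc (length (z # r))}. ?f i)"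
    by (subst sum.atLeast_Suc_lessThan) simp_all
  also have "(\<Sum>i\<in>{Suc 1..<Suc (length (z # r))}. ?f i) = (\<Sum>i\<in>{1..<length (z # r)}. ?f (Suc i))"
    by (rule sum.shift_bounds_Suc_ivl)
  also have "\<dots> = - bd (\<lambda>t. c (y # t)) (z # r)"
    unfolding 3(2) sum_negf[symmetric]
  proof (rule sum.cong[OF refl])
    fix i assume "i \<in> {1..<length (z # r)}"
    then obtain j where "i = Suc j" by (cases i) auto
    then show "?f (Suc i) = - ((-1) ^ i * (\<Sum>v\<in>between ((z # r) ! (i - 1)) ((z # r) ! i).
        c (y # (take i (z # r) @ v # drop i (z # r)))))" by simp
  qed
  finally show ?case by simp
qed auto

lemma len_insert:
  assumes "0 < i" "i < length ys"
  shows "len (take i ys @ v # drop i ys) + d (ys ! (i - 1)) (ys ! i)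
    = len ys + d (ys ! (i - 1)) v + d v (ys ! i)"
  using assms
proof (induction ys arbitrary: i rule: induct_list012)
  case (3 x y t)
  show ?case
  proof (cases "i = 1")
    case False
    then obtain j where j: "i = Suc (Suc j)" using 3 by (metis One_nat_def gr0_implies_Suc nat_neq_iff not_less_eq less_one)
    then show ?thesis using 3(2)[of "Suc j"] 3(4) by simp
  qed simp
qed auto

text \<open>After exchanging the sums, both sides are compared position by position. Tuples
  \<open>ys\<close> of the wrong length get coefficient 0 on either side.\<close>

lemma mc_bd_eq:
  assumes c: "c \<in> chains k l"
  shows "mc_bd V d (int k) (int l) c = bd c"
proof
  fix ys :: "'a list"
  let ?ins = "\<lambda>i v. take i ys @ v # drop i ys"
  let ?t = "\<lambda>i xs. if del_at i xs = ys \<and> tuple_len d (del_at i xs) = int l then (-1) ^ i * c xs else 0"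
  let ?G = "{xs. generator k l xs}"
  have finG: "finite ?G"
    by (rule finite_subset[OF _ finite_lists_length_eq[OF finite_V, of "Suc k"]]) (auto simp: generator_def)
  have lhs: "mc_bd V d (int k) (int l) c ys = (\<Sum>i\<in>{1..<k}. \<Sum>xs\<in>?G. ?t i xs)"
    unfolding mc_bd_def mc_gens_eq nat_int by (rule sum.swap)
  show "mc_bd V d (int k) (int l) c ys = bd c ys"
  proof (cases "length ys = k")
    case False
    have "?t i xs = 0" if "i \<in> {1..<k}" "xs \<in> ?G" for i xs
      using that False by (auto simp: del_at_def generator_def)
    then have "mc_bd V d (int k) (int l) c ys = 0" unfolding lhs by (intro sum.neutral ballI)
    moreover have "bd c ys = 0"
    proof (rule ccontr)
      assume "bd c ys \<noteq> 0"
      from bd_nonzero[OF this] obtain xs where xs: "insertion ys xs" "c xs \<noteq> 0" by blast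
      then have "generator k l xs" using c unfolding chains_def by blast
      then show False using insertion_length[OF xs(1)] False by (simp add: generator_def)
    qed
    ultimately show ?thesis by simp
  next
    case True
    have "(\<Sum>xs\<in>?G. ?t i xs) = (-1) ^ i * (\<Sum>v\<in>between (ys ! (i - 1)) (ys ! i). c (?ins i v))"
      if i: "i \<in> {1..<k}" for i
    proof -
      \<comment> \<open>For fixed \<open>i\<close> a tuple whose \<open>i\<close>-th deletion is
        \<open>ys\<close> is determined by its \<open>i\<close>-th entry, and by
        \<open>len_insert\<close> that entry is in between exactly when the deletion preserves
        length. Entries outside \<open>?R\<close> only meet coefficients that are 0.\<close>
      let ?S = "{xs \<in> ?G. del_at i xs = ys \<and> len ys = l}"
      let ?R = "{v \<in> between (ys ! (i - 1)) (ys ! i). generator k l (?ins i v)}"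
      have del: "del_at i (?ins i v) = ys" for v
        using i True by (simp add: del_at_def)
      have nth: "?ins i v ! i = v" "?ins i v ! (i - 1) = ys ! (i - 1)" "?ins i v ! Suc i = ys ! i" for v
        using i True by (auto simp: nth_append)
      have ins: "xs = ?ins i (xs ! i)" if "xs \<in> ?S" for xs
      proof -
        have len: "length xs = Suc k" and ys: "ys = take i xs @ drop (Suc i) xs"
          using that by (auto simp: generator_def del_at_def)
        have "take i ys = take i xs" "drop i ys = drop (Suc i) xs" unfolding ys using len i by auto
        then show ?thesis using id_take_nth_drop[of i xs] len i by simp
      qed
      have "(\<Sum>xs\<in>?G. ?t i xs) = (\<Sum>xs\<in>?S. ?t i xs)"
        by (rule sum.mono_neutral_right[OF finG]) (auto simp: tuple_len_eq)
      also have "\<dots> = (\<Sum>xs\<in>?S. (-1) ^ i * c xs)"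
        by (rule sum.cong) (auto simp: tuple_len_eq)
      also have "\<dots> = (\<Sum>v\<in>?R. (-1) ^ i * c (?ins i v))"
      proof (rule sum.reindex_bij_witness[of _ "?ins i" "\<lambda>xs. xs ! i"])
        fix xs assume xs: "xs \<in> ?S"
        show eq: "?ins i (xs ! i) = xs" using ins[OF xs] by simp
        have g: "generator k l (?ins i (xs ! i))" using xs eq by simp
        then have adj: "distinct_adj (?ins i (xs ! i))" and Vset: "set (?ins i (xs ! i)) \<subseteq> V"
          and ll: "len (?ins i (xs ! i)) = l" by (simp_all add: generator_def)
        have L: "length (?ins i (xs ! i)) = Suc k" using g by (simp add: generator_def)
        have pred: "Suc (i - 1) = i" using i by simp
        have "Suc (i - 1) < length (?ins i (xs ! i))" "Suc i < length (?ins i (xs ! i))"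
          unfolding L using i by auto
        from distinct_adj_nth[OF adj this(1), unfolded pred nth] distinct_adj_nth[OF adj this(2), unfolded nth]
        have ne: "ys ! (i - 1) \<noteq> xs ! i" "xs ! i \<noteq> ys ! i" .
        have "xs ! i \<in> V" using Vset by simp
        moreover have "ys ! (i - 1) \<in> V" "ys ! i \<in> V"
        proof -
          have "set (take i ys @ drop i ys) \<subseteq> V" using Vset unfolding set_append by simp
          then have "set ys \<subseteq> V" unfolding append_take_drop_id .
          then show "ys ! (i - 1) \<in> V" "ys ! i \<in> V" using i True by (auto simp: subset_iff)
        qed
        moreover have "d (ys ! (i - 1)) (xs ! i) + d (xs ! i) (ys ! i) = d (ys ! (i - 1)) (ys ! i)"
          using len_insert[of i ys "xs ! i"] ll xs i True by simp
        ultimately show "xs ! i \<in> ?R" using ne ne(1)[symmetric] g by (simp add: between_def)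
        show "(-1) ^ i * c (?ins i (xs ! i)) = (-1) ^ i * c xs" using eq by simp
      next
        fix v assume v: "v \<in> ?R"
        show "?ins i v ! i = v" by (rule nth(1))
        have "len ys = l"
          using v len_insert[of i ys v] i True by (auto simp: between_def generator_def)
        then show "?ins i v \<in> ?S" using v del by simp
      qed
      also have "\<dots> = (\<Sum>v\<in>between (ys ! (i - 1)) (ys ! i). (-1) ^ i * c (?ins i v))"
      proof (rule sum.mono_neutral_left)
        show "\<forall>v\<in>between (ys ! (i - 1)) (ys ! i) - ?R. (-1) ^ i * c (?ins i v) = 0"
          using c unfolding chains_def by auto
      qed auto
      finally show ?thesis by (simp add: sum_distrib_left)
    qed
    then show ?thesis unfolding lhs bd_eq_sum_insertions True by (intro sum.cong refl)
  qed
qed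

lemma mh_cycles_eq: "mh_cycles V d (int k) (int l) = cycles k l"
  unfolding mh_cycles_def cycles_def mc_chains_eq zero_fun_def using mc_bd_eq by auto

lemma mh_boundaries_eq: "mh_boundaries V d (int k) (int l) = boundaries k l"
proof -
  have Suc: "int k + 1 = int (Suc k)" by simp
  show ?thesis
    unfolding mh_boundaries_def boundaries_def Suc mc_chains_eq by (intro image_cong refl mc_bd_eq)
qed

lemma mc_bd_0: "mc_bd V d k l (\<lambda>_. 0) = (\<lambda>_. 0)"
  by (simp add: mc_bd_def cong: if_cong)

lemma mh_negative:
  assumes "k < 0 \<or> l < 0"
  shows "mh_cycles V d k l = {0}" "mh_boundaries V d k l = {0}"
proof -
  have ch: "mc_chains V d j l = {0}" if "j < 0 \<or> l < 0" for j
    using that by (auto simp: mc_chains_def mc_gens_def tuple_len_eq zero_fun_def fun_eq_iff)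
  show "mh_cycles V d k l = {0}"
    unfolding mh_cycles_def ch[OF assms] using mc_bd_0 by (auto simp: zero_fun_def)
  show "mh_boundaries V d k l = {0}"
  proof (cases "k + 1 < 0 \<or> l < 0")
    case True
    then show ?thesis unfolding mh_boundaries_def ch[OF True] using mc_bd_0 by (auto simp: zero_fun_def)
  next
    case False
    \<comment> \<open>For \<open>k = -1\<close> the boundaries come from chains of degree 0, which
      may be nonzero; their boundary is an empty sum over deletion positions.\<close>
    then have "k + 1 = 0" using assms by auto
    moreover have "0 \<in> mc_chains V d 0 l" by (simp add: mc_chains_def)
    ultimately show ?thesis unfolding mh_boundaries_def by (auto simp: mc_bd_def zero_fun_def)
  qed
qed

theorem mh_cycle:
  assumes orient: "orientation m b" and V: "V \<noteq> {}"
  shows "mh_torsion_free V d k l" "int (mh_rank V d k l) = T_fun (int m) k l"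
proof -
  let ?Z = "mh_cycles V d k l" and ?B = "mh_boundaries V d k l"
  have nat: "\<exists>k' l'. k = int k' \<and> l = int l'" if "\<not> (k < 0 \<or> l < 0)"
    using that by (intro exI[of _ "nat k"] exI[of _ "nat l"]) auto
  have "\<exists>A :: 'a list set. finite A \<and> free_quotient_on ?Z ?B A \<and> int (card A) = T_fun (int m) k l"
  proof (cases "k < 0 \<or> l < 0")
    case True
    have "free_quotient_on {0 :: 'a list \<Rightarrow> int} {0} ({} :: 'a list set)"
      by (rule free_quotient_on_trivial) auto
    then show ?thesis unfolding mh_negative[OF True] T_fun_neg[OF True] by (intro exI[of _ "{}"]) simp
  next
    case False
    from nat[OF this] obtain k' l' where kl: "k = int k'" "l = int l'" by blast
    show ?thesis unfolding kl mh_cycles_eq mh_boundaries_eq by (rule free_quotient_on_T_fun[OF orient V])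
  qed
  then obtain A :: "'a list set" where A: "finite A" "free_quotient_on ?Z ?B A" "int (card A) = T_fun (int m) k l"
    by blast
  have cl: "0 \<in> ?Z" "c \<in> ?Z \<Longrightarrow> e \<in> ?Z \<Longrightarrow> c + e \<in> ?Z" "c \<in> ?Z \<Longrightarrow> (\<lambda>x. n * c x) \<in> ?Z" for c e n
  proof (atomize (full), cases "k < 0 \<or> l < 0")
    case True
    have "(\<lambda>x. n * (0 :: 'a list \<Rightarrow> int) x) = 0" by (simp add: fun_eq_iff)
    then show "0 \<in> ?Z \<and> (c \<in> ?Z \<longrightarrow> e \<in> ?Z \<longrightarrow> c + e \<in> ?Z) \<and> (c \<in> ?Z \<longrightarrow> (\<lambda>x. n * c x) \<in> ?Z)"
      unfolding mh_negative[OF True] singleton_iff by (intro conjI impI) simp_all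
  next
    case False
    from nat[OF this] obtain k' l' where kl: "k = int k'" "l = int l'" by blast
    show "0 \<in> ?Z \<and> (c \<in> ?Z \<longrightarrow> e \<in> ?Z \<longrightarrow> c + e \<in> ?Z) \<and> (c \<in> ?Z \<longrightarrow> (\<lambda>x. n * c x) \<in> ?Z)"
      unfolding kl mh_cycles_eq by (intro conjI impI cycles_0 cycles_add cycles_scale)
  qed
  show "mh_torsion_free V d k l"
    using A(2,1) cl by (rule free_quotient_on_mh(1))
  have "mh_rank V d k l = card A"
    using A(2,1) cl by (rule free_quotient_on_mh(2))
  then show "int (mh_rank V d k l) = T_fun (int m) k l" using A(3) by simp
qed

end

section \<open>The metric and orientation of a cycle graph\<close>

text \<open>The residue of \<open>y - x\<close> modulo \<open>n\<close> for vertices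
  \<open>x\<close>, \<open>y\<close> below \<open>n\<close>, split into cases to avoid truncated
  subtraction.\<close>

definition cycle_arc :: "nat \<Rightarrow> nat \<Rightarrow> nat \<Rightarrow> nat" where
  "cycle_arc n x y = (if x \<le> y then y - x else y + n - x)"

lemma Suc_mod_cycle: "x < n \<Longrightarrow> Suc x mod n = (if Suc x = n then 0 else Suc x)"
  by auto

lemma cycle_arc_step:
  assumes "cycle_E n x z" "y < n"
  shows "min (cycle_arc n x y) (cycle_arc n y x) \<le> Suc (min (cycle_arc n z y) (cycle_arc n y z))"
proof -
  have xz: "x < n" "z < n" and "z = Suc x mod n \<or> x = Suc z mod n"
    using assms(1) unfolding cycle_E_def by blast+
  then have "z = (if Suc x = n then 0 else Suc x) \<or> x = (if Suc z = n then 0 else Suc z)"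
    unfolding Suc_mod_cycle[OF xz(1)] Suc_mod_cycle[OF xz(2)] by blast
  then show ?thesis
  proof
    assume "z = (if Suc x = n then 0 else Suc x)"
    then show ?thesis using xz assms(2) unfolding cycle_arc_def by (cases "Suc x = n") auto
  next
    assume "x = (if Suc z = n then 0 else Suc z)"
    then show ?thesis using xz assms(2) unfolding cycle_arc_def by (cases "Suc z = n") auto
  qed
qed

lemma is_walk_Cons_Cons:
  "is_walk V E (x # y # t) \<longleftrightarrow> x \<in> V \<and> E x y \<and> is_walk V E (y # t)"
  unfolding is_walk_def by (auto simp: nth_Cons split: nat.splits)

text \<open>The lower bound for the distance: by \<open>cycle_arc_step\<close>, one edge changes the
  smaller of the two arcs to a fixed end by at most 1.\<close>

lemma cycle_walk_length:
  assumes "is_walk (cycle_V n) (cycle_E n) p"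
  shows "min (cycle_arc n (hd p) (last p)) (cycle_arc n (last p) (hd p)) < length p"
  using assms
proof (induction p rule: induct_list012)
  case (3 x z t)
  have w: "cycle_E n x z" "is_walk (cycle_V n) (cycle_E n) (z # t)" using 3(3) by (auto simp: is_walk_Cons_Cons)
  have "last (z # t) \<in> cycle_V n" using w(2) last_in_set[of "z # t"] unfolding is_walk_def by blast
  then have "last (z # t) < n" by (simp add: cycle_V_def)
  from cycle_arc_step[OF w(1) this] show ?case using 3(2)[OF w(2)] by simp
qed (auto simp: is_walk_def cycle_arc_def)

lemma cycle_walk_exists:
  assumes "x < n" "j < n"
  shows "\<exists>p. is_walk (cycle_V n) (cycle_E n) p \<and> length p = Suc j \<and> hd p = x \<and> last p = (x + j) mod n"
proof -
  let ?p = "map (\<lambda>i. (x + i) mod n) [0..<Suc j]"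
  have "is_walk (cycle_V n) (cycle_E n) ?p"
    using assms unfolding is_walk_def
    by (auto simp: cycle_V_def cycle_E_def mod_Suc_eq simp del: upt_Suc)
  moreover have "hd ?p = x" using assms by (simp add: hd_map del: upt_Suc)
  moreover have "last ?p = (x + j) mod n" by simp
  ultimately show ?thesis by (intro exI[of _ ?p]) simp
qed

lemma cycle_walk_rev:
  assumes "is_walk (cycle_V n) (cycle_E n) p"
  shows "is_walk (cycle_V n) (cycle_E n) (rev p)"
proof -
  have "cycle_E n (rev p ! i) (rev p ! Suc i)" if "Suc i < length p" for i
  proof -
    have "cycle_E n (p ! (length p - Suc (Suc i))) (p ! Suc (length p - Suc (Suc i)))"
      using assms that unfolding is_walk_def by auto
    moreover have "Suc (length p - Suc (Suc i)) = length p - Suc i" using that by simp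
    ultimately show ?thesis using that by (auto simp: rev_nth cycle_E_def)
  qed
  then show ?thesis using assms by (auto simp: is_walk_def)
qed

lemma cycle_dist_eq:
  assumes "x < n" "y < n"
  shows "cycle_dist n x y = min (cycle_arc n x y) (cycle_arc n y x)"
  unfolding cycle_dist_def graph_dist_def
proof (rule Least_equality)
  have arc: "cycle_arc n u v < n" "(u + cycle_arc n u v) mod n = v" if "u < n" "v < n" for u v
    using that by (auto simp: cycle_arc_def)
  show "\<exists>p. is_walk (cycle_V n) (cycle_E n) p \<and> length p = Suc (min (cycle_arc n x y) (cycle_arc n y x)) \<and> hd p = x \<and> last p = y"
  proof (cases "cycle_arc n x y \<le> cycle_arc n y x")
    case True
    then show ?thesis using cycle_walk_exists[OF assms(1) arc(1)[OF assms]] arc(2)[OF assms] by (simp add: min_def)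
  next
    case False
    \<comment> \<open>The shorter way from \<open>x\<close> to \<open>y\<close> runs backwards, so
      the increasing walk from \<open>y\<close> to \<open>x\<close> is taken and reversed.\<close>
    obtain p where p: "is_walk (cycle_V n) (cycle_E n) p" "length p = Suc (cycle_arc n y x)" "hd p = y" "last p = x"
      using cycle_walk_exists[OF assms(2) arc(1)[OF assms(2,1)]] arc(2)[OF assms(2,1)] by auto
    then have "p \<noteq> []" by auto
    then show ?thesis using False p cycle_walk_rev[OF p(1)]
      by (intro exI[of _ "rev p"]) (simp add: hd_rev last_rev min_def)
  qed
next
  fix j assume "\<exists>p. is_walk (cycle_V n) (cycle_E n) p \<and> length p = Suc j \<and> hd p = x \<and> last p = y"
  then show "min (cycle_arc n x y) (cycle_arc n y x) \<le> j" using cycle_walk_length by fastforce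
qed

lemma cycle_arc_add:
  assumes "x < n" "y < n" "z < n"
  shows "cycle_arc n x y + cycle_arc n y z = cycle_arc n x z
    \<or> cycle_arc n x y + cycle_arc n y z = cycle_arc n x z + n"
  using assms unfolding cycle_arc_def by (cases "x \<le> y"; cases "y \<le> z"; cases "x \<le> z") (simp_all add: add.commute)

lemma cycle_arc_0: "x < n \<Longrightarrow> y < n \<Longrightarrow> cycle_arc n x y = 0 \<longleftrightarrow> x = y"
  by (auto simp: cycle_arc_def)

lemma finite_metric_cycle: "finite_metric (cycle_V n) (cycle_dist n)"
proof
  show "finite (cycle_V n)" by (simp add: cycle_V_def)
next
  fix x y assume "x \<in> cycle_V n" "y \<in> cycle_V n"
  then have "x < n" "y < n" by (simp_all add: cycle_V_def)
  then show "cycle_dist n x y = 0 \<longleftrightarrow> x = y"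
    using cycle_arc_0[of x n y] cycle_arc_0[of y n x] by (auto simp: cycle_dist_eq min_def)
next
  fix x y z assume "x \<in> cycle_V n" "y \<in> cycle_V n" "z \<in> cycle_V n"
  then have V: "x < n" "y < n" "z < n" by (simp_all add: cycle_V_def)
  have "cycle_arc n x z + cycle_arc n z x \<le> n"
    using V unfolding cycle_arc_def by auto
  then show "cycle_dist n x z \<le> cycle_dist n x y + cycle_dist n y z"
    unfolding cycle_dist_eq[OF V(1,3)] cycle_dist_eq[OF V(1,2)] cycle_dist_eq[OF V(2,3)]
    using cycle_arc_add[OF V] cycle_arc_add[OF V(3,2,1)] cycle_arc_add[OF V(1,3,2)] cycle_arc_add[OF V(3,1,2)]
    by linarith
qed

lemma orientation_cycle:
  assumes "3 \<le> m"
  shows "finite_metric.orientation (cycle_V (2 * m)) (cycle_dist (2 * m)) m (cycle_arc (2 * m))"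
proof -
  interpret finite_metric "cycle_V (2 * m)" "cycle_dist (2 * m)" by (rule finite_metric_cycle)
  have V: "x \<in> cycle_V (2 * m) \<longleftrightarrow> x < 2 * m" for x by (simp add: cycle_V_def)
  have "\<exists>y\<in>cycle_V (2 * m). cycle_arc (2 * m) x y = j" if "x < 2 * m" "j < 2 * m" for x j
  proof (cases "x + j < 2 * m")
    case True
    then show ?thesis by (intro bexI[of _ "x + j"]) (simp_all add: cycle_arc_def V)
  next
    case False
    then show ?thesis using that by (intro bexI[of _ "x + j - 2 * m"]) (auto simp: cycle_arc_def V)
  qed
  moreover have "cycle_arc (2 * m) x y < 2 * m" if "x < 2 * m" "y < 2 * m" for x y
    using that by (auto simp: cycle_arc_def)
  ultimately show ?thesis
    unfolding orientation_def Ball_def V using assms cycle_arc_0 cycle_dist_eq cycle_arc_add by simp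
qed

theorem theorem3p6:
  fixes m :: nat
  assumes "m \<ge> 3"
  shows "(\<forall>k l. mh_torsion_free (cycle_V (2 * m)) (cycle_dist (2 * m)) k l) \<and>
         (\<forall>k l. int (mh_rank (cycle_V (2 * m)) (cycle_dist (2 * m)) k l) = T_fun (int m) k l)"
proof -
  have "0 \<in> cycle_V (2 * m)" using assms by (simp add: cycle_V_def)
  then have "cycle_V (2 * m) \<noteq> {}" by blast
  with finite_metric.mh_cycle[OF finite_metric_cycle orientation_cycle[OF assms]] show ?thesis by blast
qed

end
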